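(* Let $(M,g)$ be a Lorentzian manifold and $L$ a totally geodesic null hypersurface of $M$ with a rigging $\zeta$. Let $\xi$ be the rigged vector field and $\tilde g$ the rigged metric on $L$ induced by $\zeta$. Then the null foliation of $L$ (the one-dimensional foliation by integral curves of $\xi$) is a Riemannian flow for which the rigged metric $\tilde g$ is bundle-like. If in addition the rigging $\zeta$ is closed, then this flow is isometric.
   Context: Rigging. A null hypersurface $L$ of a Lorentzian manifold $(M,g)$, with inclusion $i:L\to M$, is a hypersurface on which the induced tensor $i^*g$ is degenerate at every point. A rigging for $L$ is a vector field $\zeta$ defined on an open set containing $L$ with $\zeta_p\notin T_pL$ for all $p\in L$. Let $\alpha=g(\zeta,\cdot)$ and $\omega=i^*\alpha$ (the rigged 1-form). The rigged metric $\tilde g=i^*(g+\alpha\otimes\alpha)$ is a Riemannian metric on $L$, and the rigged vector field $\xi\in\mathfrak X(L)$ is defined by $\tilde g(\xi,\cdot)=\omega$; it is null for $g$, $\tilde g$-unit, and $g(\zeta,\xi)=1$. The rigging is closed if $d\alpha=0$. $L$ is totally geodesic if $B(U,V):=g(\nabla_UV,\xi)=0$ for all $U,V\in\mathfrak X(L)$, where $\nabla$ is the Levi-Civita connection of $g$. Riemannian foliations. Let $F$ be a foliation of a manifold $L$ and $Q=TL/TF$, with projection $\pi:TL\to Q$. A Riemannian metric $g_T$ on the bundle $Q$ is holonomy invariant if $\mathcal L_Xg_T=0$ for every vector field $X$ tangent to $F$, where $(\mathcal L_Xg_T)(\pi Y,\pi Z)=X(g_T(\pi Y,\pi Z))-g_T(\pi[X,Y],\pi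 Z)-g_T(\pi Y,\pi[X,Z])$. $F$ is a Riemannian foliation if $Q$ admits a holonomy invariant metric; if $F$ is one-dimensional it is called a Riemannian flow. A Riemannian metric on $L$ is bundle-like if the metric it induces on $Q\cong TF^\perp$ is holonomy invariant. A Riemannian flow $F$ on $L$ is isometric if there exist a Riemannian metric $h$ on $L$ and a nowhere vanishing Killing vector field $X$ of $h$ such that the leaves of $F$ are the orbits of $X$. *)

theory Defs
  imports "HOL-Analysis.Analysis"
begin

section \<open>Smooth functions on open subsets of Euclidean spaces\<close>

text \<open>\<open>Ck_on k S f\<close> (for open \<open>S\<close>): \<open>f\<close> is \<open>k\<close> times continuously differentiable on \<open>S\<close>. The
  recursion goes over all directional derivatives.\<close>

primrec Ck_on ::
    "nat \<Rightarrow> 'a::euclidean_space set \<Rightarrow> ('a \<Rightarrow> 'b::euclidean_space) \<Rightarrow> bool" where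
  "Ck_on 0 S f \<longleftrightarrow> continuous_on S f"
| "Ck_on (Suc k) S f \<longleftrightarrow>
     (\<forall>x\<in>S. f differentiable at x) \<and> (\<forall>v. Ck_on k S (\<lambda>x. frechet_derivative f (at x) v))"

definition smooth_on :: "'a::euclidean_space set \<Rightarrow> ('a \<Rightarrow> 'b::euclidean_space) \<Rightarrow> bool" where
  "smooth_on S f \<longleftrightarrow> (\<forall>k. Ck_on k S f)"

section \<open>Smooth manifolds\<close>

text \<open>A chart is a pair of its domain and a map; values of the map off the domain are irrelevant.\<close>

type_synonym ('a, 'e) chart = "'a set \<times> ('a \<Rightarrow> 'e)"

abbreviation cdom :: "('a, 'e) chart \<Rightarrow> 'a set" where "cdom \<equiv> fst"
abbreviation cmap :: "('a, 'e) chart \<Rightarrow> 'a \<Rightarrow> 'e" where "cmap \<equiv> snd"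

definition cinv :: "('a, 'e) chart \<Rightarrow> 'e \<Rightarrow> 'a" where
  "cinv \<phi> = inv_into (cdom \<phi>) (cmap \<phi>)"

record ('a, 'e) manifold =
  topo :: "'a topology"
  atlas :: "('a, 'e) chart set"

abbreviation carrier :: "('a, 'e) manifold \<Rightarrow> 'a set" where
  "carrier M \<equiv> topspace (topo M)"

definition smooth_manifold :: "('a, 'e::euclidean_space) manifold \<Rightarrow> bool" where
  "smooth_manifold M \<longleftrightarrow>
     Hausdorff_space (topo M) \<and>
     (\<exists>\<B>. countable \<B> \<and> (\<forall>V\<in>\<B>. openin (topo M) V) \<and>
        (\<forall>U p. openin (topo M) U \<and> p \<in> U \<longrightarrow> (\<exists>V\<in>\<B>. p \<in> V \<and> V \<subseteq> U))) \<and>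
     (\<Union>\<phi>\<in>atlas M. cdom \<phi>) = carrier M \<and>
     (\<forall>\<phi>\<in>atlas M. openin (topo M) (cdom \<phi>) \<and> open (cmap \<phi> ` cdom \<phi>) \<and>
        homeomorphic_map (subtopology (topo M) (cdom \<phi>)) (top_of_set (cmap \<phi> ` cdom \<phi>)) (cmap \<phi>)) \<and>
     (\<forall>\<phi>\<in>atlas M. \<forall>\<psi>\<in>atlas M. smooth_on (cmap \<phi> ` (cdom \<phi> \<inter> cdom \<psi>)) (cmap \<psi> \<circ> cinv \<phi>))"

text \<open>Tangent vectors at \<open>p\<close> are encoded by their components in a fixed preferred chart at \<open>p\<close>, so
  that each tangent space is a copy of the model space \<open>'e\<close>. The components in an arbitrary chart
  (\<open>to_coords\<close>), and the vector with given components in an arbitrary chart (\<open>from_coords\<close>),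
  are obtained from the derivative of the transition map. A vector field assigns to \<open>q\<close> the
  components in the preferred chart at \<open>q\<close>, which need not vary continuously with \<open>q\<close>: smoothness
  and derivatives always have to be taken after passing to one chart.\<close>

definition chart_at :: "('a, 'e) manifold \<Rightarrow> 'a \<Rightarrow> ('a, 'e) chart" where
  "chart_at M p = (SOME \<phi>. \<phi> \<in> atlas M \<and> p \<in> cdom \<phi>)"

definition to_coords ::
    "('a, 'e::euclidean_space) manifold \<Rightarrow> ('a, 'e) chart \<Rightarrow> 'a \<Rightarrow> 'e \<Rightarrow> 'e" where
  "to_coords M \<phi> p v =
     frechet_derivative (cmap \<phi> \<circ> cinv (chart_at M p)) (at (cmap (chart_at M p) p)) v"

definition from_coords ::
    "('a, 'e::euclidean_space) manifold \<Rightarrow> ('a, 'e) chart \<Rightarrow> 'a \<Rightarrow> 'e \<Rightarrow> 'e" where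
  "from_coords M \<phi> p u =
     frechet_derivative (cmap (chart_at M p) \<circ> cinv \<phi>) (at (cmap \<phi> p)) u"

text \<open>The derivative \<open>v(f)\<close> of a function \<open>f\<close> by a tangent vector \<open>v\<close> at \<open>p\<close>.\<close>

definition dir_deriv ::
    "('a, 'e::euclidean_space) manifold \<Rightarrow> ('a \<Rightarrow> real) \<Rightarrow> 'a \<Rightarrow> 'e \<Rightarrow> real" where
  "dir_deriv M f p v =
     frechet_derivative (f \<circ> cinv (chart_at M p)) (at (cmap (chart_at M p) p)) v"

definition field_coords ::
    "('a, 'e::euclidean_space) manifold \<Rightarrow> ('a, 'e) chart \<Rightarrow> ('a \<Rightarrow> 'e) \<Rightarrow> 'e \<Rightarrow> 'e" where
  "field_coords M \<phi> X x = to_coords M \<phi> (cinv \<phi> x) (X (cinv \<phi> x))"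

definition vector_field_on ::
    "('a, 'e::euclidean_space) manifold \<Rightarrow> 'a set \<Rightarrow> ('a \<Rightarrow> 'e) \<Rightarrow> bool" where
  "vector_field_on M U X \<longleftrightarrow>
     (\<forall>\<phi>\<in>atlas M. smooth_on (cmap \<phi> ` (cdom \<phi> \<inter> U)) (field_coords M \<phi> X))"

abbreviation vector_field :: "('a, 'e::euclidean_space) manifold \<Rightarrow> ('a \<Rightarrow> 'e) \<Rightarrow> bool" where
  "vector_field M X \<equiv> vector_field_on M (carrier M) X"

text \<open>\<open>[X,Y]\<^sup>i = X\<^sup>j \<partial>\<^sub>j Y\<^sup>i - Y\<^sup>j \<partial>\<^sub>j X\<^sup>i\<close>, in the preferred chart at \<open>p\<close>.\<close>

definition lie_bracket ::
    "('a, 'e::euclidean_space) manifold \<Rightarrow> ('a \<Rightarrow> 'e) \<Rightarrow> ('a \<Rightarrow> 'e) \<Rightarrow> 'a \<Rightarrow> 'e" where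
  "lie_bracket M X Y p =
     (let \<phi> = chart_at M p in
       frechet_derivative (field_coords M \<phi> Y) (at (cmap \<phi> p)) (X p) -
       frechet_derivative (field_coords M \<phi> X) (at (cmap \<phi> p)) (Y p))"

section \<open>Metrics and one-forms\<close>

type_synonym ('a, 'e) tensor2 = "'a \<Rightarrow> 'e \<Rightarrow> 'e \<Rightarrow> real"

definition tensor_coords :: "('a, 'e::euclidean_space) manifold \<Rightarrow> ('a, 'e) chart \<Rightarrow>
    ('a, 'e) tensor2 \<Rightarrow> 'e \<Rightarrow> 'e \<Rightarrow> 'e \<Rightarrow> real" where
  "tensor_coords M \<phi> g x u v =
     (let q = cinv \<phi> x in g q (from_coords M \<phi> q u) (from_coords M \<phi> q v))"

definition symmetric_tensor_field ::
    "('a, 'e::euclidean_space) manifold \<Rightarrow> ('a, 'e) tensor2 \<Rightarrow> bool" where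
  "symmetric_tensor_field M g \<longleftrightarrow>
     (\<forall>p\<in>carrier M. bilinear (g p) \<and> (\<forall>u v. g p u v = g p v u)) \<and>
     (\<forall>\<phi>\<in>atlas M. \<forall>u v. smooth_on (cmap \<phi> ` cdom \<phi>) (\<lambda>x. tensor_coords M \<phi> g x u v))"

definition riemannian_metric ::
    "('a, 'e::euclidean_space) manifold \<Rightarrow> ('a, 'e) tensor2 \<Rightarrow> bool" where
  "riemannian_metric M g \<longleftrightarrow>
     symmetric_tensor_field M g \<and> (\<forall>p\<in>carrier M. \<forall>u. u \<noteq> 0 \<longrightarrow> g p u u > 0)"

definition lorentzian_form :: "('e::euclidean_space \<Rightarrow> 'e \<Rightarrow> real) \<Rightarrow> bool" where
  "lorentzian_form b \<longleftrightarrow>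
     (\<exists>B t. independent B \<and> span B = UNIV \<and> t \<in> B \<and> b t t = -1 \<and>
        (\<forall>u\<in>B - {t}. b u u = 1) \<and> (\<forall>u\<in>B. \<forall>v\<in>B. u \<noteq> v \<longrightarrow> b u v = 0))"

definition lorentzian_manifold ::
    "('a, 'e::euclidean_space) manifold \<Rightarrow> ('a, 'e) tensor2 \<Rightarrow> bool" where
  "lorentzian_manifold M g \<longleftrightarrow>
     smooth_manifold M \<and> DIM('e) \<ge> 2 \<and> symmetric_tensor_field M g \<and>
     (\<forall>p\<in>carrier M. lorentzian_form (g p))"

text \<open>\<open>d\<alpha>(u,v) = u\<^sup>i v\<^sup>j (\<partial>\<^sub>i \<alpha>\<^sub>j - \<partial>\<^sub>j \<alpha>\<^sub>i)\<close>, in the preferred chart at \<open>p\<close>.\<close>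

definition form_coords :: "('a, 'e::euclidean_space) manifold \<Rightarrow> ('a, 'e) chart \<Rightarrow>
    ('a \<Rightarrow> 'e \<Rightarrow> real) \<Rightarrow> 'e \<Rightarrow> 'e \<Rightarrow> real" where
  "form_coords M \<phi> \<alpha> x v = \<alpha> (cinv \<phi> x) (from_coords M \<phi> (cinv \<phi> x) v)"

definition ext_deriv ::
    "('a, 'e::euclidean_space) manifold \<Rightarrow> ('a \<Rightarrow> 'e \<Rightarrow> real) \<Rightarrow> ('a, 'e) tensor2" where
  "ext_deriv M \<alpha> p u v =
     (let \<phi> = chart_at M p in
       frechet_derivative (\<lambda>x. form_coords M \<phi> \<alpha> x v) (at (cmap \<phi> p)) u -
       frechet_derivative (\<lambda>x. form_coords M \<phi> \<alpha> x u) (at (cmap \<phi> p)) v)"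

text \<open>\<open>(\<L>\<^sub>X h)(Y,Z) = X(h(Y,Z)) - h([X,Y],Z) - h(Y,[X,Z])\<close>.\<close>

definition lie_deriv_metric :: "('a, 'e::euclidean_space) manifold \<Rightarrow> ('a \<Rightarrow> 'e) \<Rightarrow>
    ('a, 'e) tensor2 \<Rightarrow> ('a \<Rightarrow> 'e) \<Rightarrow> ('a \<Rightarrow> 'e) \<Rightarrow> 'a \<Rightarrow> real" where
  "lie_deriv_metric M X h Y Z p =
     dir_deriv M (\<lambda>q. h q (Y q) (Z q)) p (X p)
     - h p (lie_bracket M X Y p) (Z p) - h p (Y p) (lie_bracket M X Z p)"

definition killing_field ::
    "('a, 'e::euclidean_space) manifold \<Rightarrow> ('a, 'e) tensor2 \<Rightarrow> ('a \<Rightarrow> 'e) \<Rightarrow> bool" where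
  "killing_field M h X \<longleftrightarrow> vector_field M X \<and>
     (\<forall>Y Z. vector_field M Y \<and> vector_field M Z \<longrightarrow>
        (\<forall>p\<in>carrier M. lie_deriv_metric M X h Y Z p = 0))"

section \<open>Hypersurfaces and the Levi-Civita connection along them\<close>

text \<open>A hypersurface of \<open>M\<close> is a manifold \<open>L\<close> of codimension one on a subset of \<open>M\<close>, such that the
  inclusion is a smooth immersion. The topology of \<open>L\<close> is not required to be the subspace topology,
  so besides embedded hypersurfaces also injectively immersed ones are covered. As points of \<open>L\<close> are
  points of \<open>M\<close>, the inclusion is the identity and does not appear in its coordinate expressions.\<close>

definition incl_deriv :: "('a, 'e::euclidean_space) manifold \<Rightarrow>
    ('a, 'f::euclidean_space) manifold \<Rightarrow> 'a \<Rightarrow> 'f \<Rightarrow> 'e" where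
  "incl_deriv M L p u =
     frechet_derivative (cmap (chart_at M p) \<circ> cinv (chart_at L p)) (at (cmap (chart_at L p) p)) u"

definition hypersurface ::
    "('a, 'e::euclidean_space) manifold \<Rightarrow> ('a, 'f::euclidean_space) manifold \<Rightarrow> bool" where
  "hypersurface M L \<longleftrightarrow>
     smooth_manifold L \<and> DIM('e) = DIM('f) + 1 \<and>
     continuous_map (topo L) (topo M) (\<lambda>p. p) \<and>
     (\<forall>\<phi>\<in>atlas L. \<forall>\<psi>\<in>atlas M. smooth_on (cmap \<phi> ` (cdom \<phi> \<inter> cdom \<psi>)) (cmap \<psi> \<circ> cinv \<phi>)) \<and>
     (\<forall>p\<in>carrier L. inj (incl_deriv M L p))"

definition null_hypersurface :: "('a, 'e::euclidean_space) manifold \<Rightarrow> ('a, 'e) tensor2 \<Rightarrow>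
    ('a, 'f::euclidean_space) manifold \<Rightarrow> bool" where
  "null_hypersurface M g L \<longleftrightarrow> hypersurface M L \<and>
     (\<forall>p\<in>carrier L. \<exists>u. u \<noteq> 0 \<and> (\<forall>v. g p (incl_deriv M L p u) (incl_deriv M L p v) = 0))"

text \<open>The Christoffel symbols at \<open>p\<close> in the preferred chart, as a bilinear map, characterised by the
  two properties of the Levi-Civita connection: it is torsion-free, and \<open>\<nabla>g = 0\<close>, i.e.
  \<open>w(g(u,v)) = g(\<nabla>\<^sub>w u, v) + g(u, \<nabla>\<^sub>w v)\<close> for \<open>u, v\<close> with constant components.\<close>

definition christoffel ::
    "('a, 'e::euclidean_space) manifold \<Rightarrow> ('a, 'e) tensor2 \<Rightarrow> 'a \<Rightarrow> 'e \<Rightarrow> 'e \<Rightarrow> 'e" where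
  "christoffel M g p = (THE \<Gamma>. bilinear \<Gamma> \<and> (\<forall>u v. \<Gamma> u v = \<Gamma> v u) \<and>
     (let \<phi> = chart_at M p in
       \<forall>w u v. frechet_derivative (\<lambda>x. tensor_coords M \<phi> g x u v) (at (cmap \<phi> p)) w
         = g p (\<Gamma> w u) v + g p u (\<Gamma> w v)))"

text \<open>\<open>\<nabla>\<^sub>U V\<close> at \<open>p\<close>, for \<open>U, V\<close> tangent to \<open>L\<close>: \<open>(\<nabla>\<^sub>U V)\<^sup>k = U(V\<^sup>k) + \<Gamma>\<^sup>k\<^sub>i\<^sub>j U\<^sup>i V\<^sup>j\<close>, where \<open>V\<^sup>k\<close> are
  the components of \<open>V\<close> in the preferred chart of \<open>M\<close> at \<open>p\<close>, as functions on \<open>L\<close>.\<close>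

definition levi_civita_along :: "('a, 'e::euclidean_space) manifold \<Rightarrow> ('a, 'e) tensor2 \<Rightarrow>
    ('a, 'f::euclidean_space) manifold \<Rightarrow> ('a \<Rightarrow> 'f) \<Rightarrow> ('a \<Rightarrow> 'f) \<Rightarrow> 'a \<Rightarrow> 'e" where
  "levi_civita_along M g L U V p =
     frechet_derivative
       ((\<lambda>q. to_coords M (chart_at M p) q (incl_deriv M L q (V q))) \<circ> cinv (chart_at L p))
       (at (cmap (chart_at L p) p)) (U p)
     + christoffel M g p (incl_deriv M L p (U p)) (incl_deriv M L p (V p))"

definition totally_geodesic :: "('a, 'e::euclidean_space) manifold \<Rightarrow> ('a, 'e) tensor2 \<Rightarrow>
    ('a, 'f::euclidean_space) manifold \<Rightarrow> ('a \<Rightarrow> 'f) \<Rightarrow> bool" where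
  "totally_geodesic M g L \<xi> \<longleftrightarrow>
     (\<forall>U V. vector_field L U \<and> vector_field L V \<longrightarrow>
       (\<forall>p\<in>carrier L. g p (levi_civita_along M g L U V p) (incl_deriv M L p (\<xi> p)) = 0))"

section \<open>Riggings\<close>

text \<open>\<open>W\<close> is the open set on which the rigging \<open>\<zeta>\<close> is defined.\<close>

definition rigging :: "('a, 'e::euclidean_space) manifold \<Rightarrow> ('a, 'f::euclidean_space) manifold \<Rightarrow>
    'a set \<Rightarrow> ('a \<Rightarrow> 'e) \<Rightarrow> bool" where
  "rigging M L W \<zeta> \<longleftrightarrow>
     openin (topo M) W \<and> carrier L \<subseteq> W \<and> vector_field_on M W \<zeta> \<and>
     (\<forall>p\<in>carrier L. \<zeta> p \<notin> range (incl_deriv M L p))"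

definition rigging_form :: "('a, 'e) tensor2 \<Rightarrow> ('a \<Rightarrow> 'e) \<Rightarrow> 'a \<Rightarrow> 'e \<Rightarrow> real" where
  "rigging_form g \<zeta> p v = g p (\<zeta> p) v"

definition closed_rigging :: "('a, 'e::euclidean_space) manifold \<Rightarrow> ('a, 'e) tensor2 \<Rightarrow>
    'a set \<Rightarrow> ('a \<Rightarrow> 'e) \<Rightarrow> bool" where
  "closed_rigging M g W \<zeta> \<longleftrightarrow> (\<forall>p\<in>W. \<forall>u v. ext_deriv M (rigging_form g \<zeta>) p u v = 0)"

definition rigged_form :: "('a, 'e::euclidean_space) manifold \<Rightarrow> ('a, 'e) tensor2 \<Rightarrow>
    ('a, 'f::euclidean_space) manifold \<Rightarrow> ('a \<Rightarrow> 'e) \<Rightarrow> 'a \<Rightarrow> 'f \<Rightarrow> real" where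
  "rigged_form M g L \<zeta> p u = rigging_form g \<zeta> p (incl_deriv M L p u)"

definition rigged_metric :: "('a, 'e::euclidean_space) manifold \<Rightarrow> ('a, 'e) tensor2 \<Rightarrow>
    ('a, 'f::euclidean_space) manifold \<Rightarrow> ('a \<Rightarrow> 'e) \<Rightarrow> ('a, 'f) tensor2" where
  "rigged_metric M g L \<zeta> p u v =
     (let u' = incl_deriv M L p u; v' = incl_deriv M L p v in
       g p u' v' + rigging_form g \<zeta> p u' * rigging_form g \<zeta> p v')"

definition rigged_vector_field :: "('a, 'e::euclidean_space) manifold \<Rightarrow> ('a, 'e) tensor2 \<Rightarrow>
    ('a, 'f::euclidean_space) manifold \<Rightarrow> ('a \<Rightarrow> 'e) \<Rightarrow> ('a \<Rightarrow> 'f) \<Rightarrow> bool" where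
  "rigged_vector_field M g L \<zeta> \<xi> \<longleftrightarrow> vector_field L \<xi> \<and>
     (\<forall>p\<in>carrier L. \<forall>v. rigged_metric M g L \<zeta> p (\<xi> p) v = rigged_form M g L \<zeta> p v)"

section \<open>Riemannian foliations\<close>

text \<open>A foliation \<open>F\<close> of dimension \<open>k\<close> is given by its tangent bundle \<open>D = TF\<close>, an involutive smooth
  subbundle of \<open>TL\<close> of rank \<open>k\<close>.\<close>

definition foliation ::
    "('a, 'f::euclidean_space) manifold \<Rightarrow> nat \<Rightarrow> ('a \<Rightarrow> 'f set) \<Rightarrow> bool" where
  "foliation L k D \<longleftrightarrow>
     (\<forall>p\<in>carrier L. subspace (D p) \<and> dim (D p) = k) \<and>
     (\<forall>p\<in>carrier L. \<exists>U X. openin (topo L) U \<and> p \<in> U \<and>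
        (\<forall>i<k. vector_field_on L U (X i)) \<and>
        (\<forall>q\<in>U. D q = span ((\<lambda>i. X i q) ` {..<k}))) \<and>
     (\<forall>X Y. vector_field L X \<and> vector_field L Y \<and>
        (\<forall>p\<in>carrier L. X p \<in> D p \<and> Y p \<in> D p) \<longrightarrow>
        (\<forall>p\<in>carrier L. lie_bracket L X Y p \<in> D p))"

text \<open>Elements of the fibre of \<open>Q = TL/TF\<close> at \<open>p\<close> are the cosets of \<open>D p\<close>, and \<open>nproj D p\<close> is the
  projection. A metric on \<open>Q\<close> is a function of pairs of cosets.\<close>

definition nproj :: "('a \<Rightarrow> 'f::euclidean_space set) \<Rightarrow> 'a \<Rightarrow> 'f \<Rightarrow> 'f set" where
  "nproj D p v = (\<lambda>w. v + w) ` D p"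

type_synonym ('a, 'f) normal_tensor2 = "'a \<Rightarrow> 'f set \<Rightarrow> 'f set \<Rightarrow> real"

definition normal_metric :: "('a, 'f::euclidean_space) manifold \<Rightarrow> ('a \<Rightarrow> 'f set) \<Rightarrow>
    ('a, 'f) normal_tensor2 \<Rightarrow> bool" where
  "normal_metric L D g\<^sub>T \<longleftrightarrow>
     symmetric_tensor_field L (\<lambda>p u v. g\<^sub>T p (nproj D p u) (nproj D p v)) \<and>
     (\<forall>p\<in>carrier L. \<forall>u. nproj D p u \<noteq> nproj D p 0 \<longrightarrow> g\<^sub>T p (nproj D p u) (nproj D p u) > 0)"

definition lie_deriv_normal :: "('a, 'f::euclidean_space) manifold \<Rightarrow> ('a \<Rightarrow> 'f set) \<Rightarrow>
    ('a \<Rightarrow> 'f) \<Rightarrow> ('a, 'f) normal_tensor2 \<Rightarrow> ('a \<Rightarrow> 'f) \<Rightarrow> ('a \<Rightarrow> 'f) \<Rightarrow> 'a \<Rightarrow> real" where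
  "lie_deriv_normal L D X g\<^sub>T Y Z p =
     dir_deriv L (\<lambda>q. g\<^sub>T q (nproj D q (Y q)) (nproj D q (Z q))) p (X p)
     - g\<^sub>T p (nproj D p (lie_bracket L X Y p)) (nproj D p (Z p))
     - g\<^sub>T p (nproj D p (Y p)) (nproj D p (lie_bracket L X Z p))"

definition holonomy_invariant :: "('a, 'f::euclidean_space) manifold \<Rightarrow> ('a \<Rightarrow> 'f set) \<Rightarrow>
    ('a, 'f) normal_tensor2 \<Rightarrow> bool" where
  "holonomy_invariant L D g\<^sub>T \<longleftrightarrow>
     (\<forall>X Y Z. vector_field L X \<and> (\<forall>p\<in>carrier L. X p \<in> D p) \<and>
        vector_field L Y \<and> vector_field L Z \<longrightarrow>
        (\<forall>p\<in>carrier L. lie_deriv_normal L D X g\<^sub>T Y Z p = 0))"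

definition riemannian_foliation ::
    "('a, 'f::euclidean_space) manifold \<Rightarrow> nat \<Rightarrow> ('a \<Rightarrow> 'f set) \<Rightarrow> bool" where
  "riemannian_foliation L k D \<longleftrightarrow>
     foliation L k D \<and> (\<exists>g\<^sub>T. normal_metric L D g\<^sub>T \<and> holonomy_invariant L D g\<^sub>T)"

abbreviation riemannian_flow ::
    "('a, 'f::euclidean_space) manifold \<Rightarrow> ('a \<Rightarrow> 'f set) \<Rightarrow> bool" where
  "riemannian_flow L D \<equiv> riemannian_foliation L 1 D"

text \<open>The metric on \<open>Q\<close> induced by \<open>h\<close> through the identification of \<open>Q\<close> with the \<open>h\<close>-orthogonal
  complement of \<open>TF\<close>: \<open>normal_rep h D p a\<close> is the element of the coset \<open>a\<close> orthogonal to \<open>D p\<close>.\<close>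

definition normal_rep ::
    "('a, 'f::euclidean_space) tensor2 \<Rightarrow> ('a \<Rightarrow> 'f set) \<Rightarrow> 'a \<Rightarrow> 'f set \<Rightarrow> 'f" where
  "normal_rep h D p a = (THE u. u \<in> a \<and> (\<forall>w\<in>D p. h p u w = 0))"

definition induced_normal_metric ::
    "('a, 'f::euclidean_space) tensor2 \<Rightarrow> ('a \<Rightarrow> 'f set) \<Rightarrow> ('a, 'f) normal_tensor2" where
  "induced_normal_metric h D p a b = h p (normal_rep h D p a) (normal_rep h D p b)"

definition bundle_like :: "('a, 'f::euclidean_space) manifold \<Rightarrow> ('a \<Rightarrow> 'f set) \<Rightarrow>
    ('a, 'f) tensor2 \<Rightarrow> bool" where
  "bundle_like L D h \<longleftrightarrow> riemannian_metric L h \<and>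
     normal_metric L D (induced_normal_metric h D) \<and>
     holonomy_invariant L D (induced_normal_metric h D)"

section \<open>Orbits, leaves and isometric flows\<close>

definition integral_curve :: "('a, 'f::euclidean_space) manifold \<Rightarrow> ('a \<Rightarrow> 'f) \<Rightarrow>
    real set \<Rightarrow> (real \<Rightarrow> 'a) \<Rightarrow> bool" where
  "integral_curve L X I c \<longleftrightarrow> continuous_map (top_of_set I) (topo L) c \<and>
     (\<forall>t\<in>I. ((cmap (chart_at L (c t)) \<circ> c) has_vector_derivative X (c t)) (at t))"

definition orbit :: "('a, 'f::euclidean_space) manifold \<Rightarrow> ('a \<Rightarrow> 'f) \<Rightarrow> 'a \<Rightarrow> 'a set" where
  "orbit L X p = {c t |c a b s t. integral_curve L X {a<..<b} c \<and>
     s \<in> {a<..<b} \<and> t \<in> {a<..<b} \<and> c s = p}"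

definition orbits :: "('a, 'f::euclidean_space) manifold \<Rightarrow> ('a \<Rightarrow> 'f) \<Rightarrow> 'a set set" where
  "orbits L X = orbit L X ` carrier L"

definition smooth_curve ::
    "('a, 'f::euclidean_space) manifold \<Rightarrow> real set \<Rightarrow> (real \<Rightarrow> 'a) \<Rightarrow> bool" where
  "smooth_curve L I c \<longleftrightarrow> continuous_map (top_of_set I) (topo L) c \<and>
     (\<forall>\<phi>\<in>atlas L. smooth_on {t\<in>I. c t \<in> cdom \<phi>} (cmap \<phi> \<circ> c))"

definition velocity ::
    "('a, 'f::euclidean_space) manifold \<Rightarrow> (real \<Rightarrow> 'a) \<Rightarrow> real \<Rightarrow> 'f" where
  "velocity L c t = vector_derivative (cmap (chart_at L (c t)) \<circ> c) (at t)"

text \<open>The leaf through \<open>p\<close> of a one-dimensional foliation \<open>D\<close>. It is a connected one-dimensional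
  manifold, so it consists of the points joined to \<open>p\<close> by a regular smooth curve tangent to \<open>D\<close>.
  (For foliations of higher dimension the definition is not meant to be used.)\<close>

definition flow_leaf ::
    "('a, 'f::euclidean_space) manifold \<Rightarrow> ('a \<Rightarrow> 'f set) \<Rightarrow> 'a \<Rightarrow> 'a set" where
  "flow_leaf L D p = {c t |c a b s t. smooth_curve L {a<..<b} c \<and>
     (\<forall>r\<in>{a<..<b}. velocity L c r \<in> D (c r) \<and> velocity L c r \<noteq> 0) \<and>
     s \<in> {a<..<b} \<and> t \<in> {a<..<b} \<and> c s = p}"

definition flow_leaves ::
    "('a, 'f::euclidean_space) manifold \<Rightarrow> ('a \<Rightarrow> 'f set) \<Rightarrow> 'a set set" where
  "flow_leaves L D = flow_leaf L D ` carrier L"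

definition isometric_flow ::
    "('a, 'f::euclidean_space) manifold \<Rightarrow> ('a \<Rightarrow> 'f set) \<Rightarrow> bool" where
  "isometric_flow L D \<longleftrightarrow> riemannian_flow L D \<and>
     (\<exists>h X. riemannian_metric L h \<and> killing_field L h X \<and> (\<forall>p\<in>carrier L. X p \<noteq> 0) \<and>
        flow_leaves L D = orbits L X)"

text \<open>The foliation by integral curves of \<open>\<xi>\<close>, given by its tangent bundle.\<close>

definition null_foliation :: "('a \<Rightarrow> 'f::euclidean_space) \<Rightarrow> 'a \<Rightarrow> 'f set" where
  "null_foliation \<xi> p = span {\<xi> p}"

end

theory Submission
  imports Defs
begin

text \<open>The rigged vector field \<open>\<xi>\<close> spans the radical of \<open>h = i\<^sup>*g\<close>, so the metric that the rigged
  metric \<open>h + \<omega> \<otimes> \<omega>\<close> induces on the normal bundle is \<open>h\<close> itself. For \<open>X\<close> tangent to the null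
  foliation, \<open>(\<L>\<^sub>X h)(Y,Z) = g(\<nabla>\<^sub>Y X, Z) + g(Y, \<nabla>\<^sub>Z X)\<close>, and both terms vanish because \<open>g(X,Z) = 0\<close> and
  \<open>B = 0\<close>. If \<open>\<alpha>\<close> is closed, then \<open>\<L>\<^sub>\<xi> \<omega> = d(\<omega>(\<xi>)) + d\<omega>(\<xi>, _) = 0\<close> as \<open>\<omega>(\<xi>) = 1\<close>, so that \<open>\<xi>\<close> is
  a Killing field of the rigged metric; its orbits are the leaves, since a regular curve tangent to
  \<open>\<xi>\<close> becomes an integral curve when it is reparametrised by the integral of \<open>\<omega>\<close> along it.\<close>

section \<open>Calculus of continuously differentiable functions\<close>

text \<open>A vector at \<open>q\<close> is stored by its components in a chart chosen at
  \<open>q\<close>, and that choice may jump from point to point. Stored vectors therefore cannot be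
  differentiated directly: a field is first moved into the charts of \<open>L\<close> and
  \<open>M\<close> chosen at the point of differentiation. In these charts the inclusion has a
  second derivative of its own, and the symmetry of that derivative is what makes the connection
  along \<open>L\<close> torsion-free and lets the exterior derivative commute with the pullback to
  \<open>L\<close>. The connection is given by a definite description, so it says nothing until
  Koszul's formula has shown that its Christoffel symbols exist and are unique. That
  \<open>\<xi>\<close> spans the radical rests on the rigging being transverse: a radical vector
  with \<open>\<omega> = 0\<close> would be orthogonal to the tangent space of \<open>L\<close> and
  to \<open>\<zeta>\<close>, hence to every vector of \<open>M\<close>. In the comparison of leaves
  and orbits a regular curve may run against \<open>\<xi>\<close>, so the reparametrisation has to
  work for either sign of the speed.\<close>

abbreviation fd :: "('a::euclidean_space \<Rightarrow> 'b::euclidean_space) \<Rightarrow> 'a \<Rightarrow> 'a \<Rightarrow> 'b" where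
  "fd f x \<equiv> frechet_derivative f (at x)"

lemma fd_eqI: "(f has_derivative f') (at x) \<Longrightarrow> fd f x = f'"
  using frechet_derivative_at by metis

lemma fd_works: "f differentiable at x \<Longrightarrow> (f has_derivative fd f x) (at x)"
  using frechet_derivative_works by blast

lemma fd_cong:
  assumes "open S" "x \<in> S" "\<And>y. y \<in> S \<Longrightarrow> f y = g y"
  shows "fd f x = fd g x"
proof -
  \<comment> \<open>\<open>frechet_derivative\<close> is a Hilbert choice; equal sets of candidates
    give equal values, even at points without a derivative.\<close>
  have "(f has_derivative d) (at x) \<longleftrightarrow> (g has_derivative d) (at x)" for d
    using assms by (metis (no_types, lifting) has_derivative_transform_within_open)
  then show ?thesis unfolding frechet_derivative_def by simp
qed

lemma differentiable_cong_open:
  assumes "open S" "x \<in> S" "\<And>y. y \<in> S \<Longrightarrow> f y = g y" "f differentiable at x"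
  shows "g differentiable at x"
  using assms by (metis (no_types, lifting) has_derivative_transform_within_open differentiable_def)

lemma Ck_on_cong:
  assumes "open S" "\<And>x. x \<in> S \<Longrightarrow> f x = g x" "Ck_on k S f"
  shows "Ck_on k S g"
  using assms
proof (induction k arbitrary: f g)
  case 0
  then show ?case using continuous_on_cong by force
next
  case (Suc k)
  have "g differentiable at x" if "x \<in> S" for x
    using differentiable_cong_open[of S x f g] that Suc by simp
  moreover have "Ck_on k S (\<lambda>x. fd g x v)" for v
    by (rule Suc.IH[of "\<lambda>x. fd f x v"]) (use Suc.prems fd_cong[of S _ f g] in auto)
  ultimately show ?case by simp
qed

lemma Ck_on_subset: "Ck_on k S f \<Longrightarrow> T \<subseteq> S \<Longrightarrow> Ck_on k T f"
  by (induction k arbitrary: f) (auto intro: continuous_on_subset)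

text \<open>Derivatives in \<open>Ck_on\<close> are taken \<open>at x\<close>, never within
  \<open>S\<close>, so the condition can be tested on a neighbourhood of each point.\<close>

lemma Ck_on_locally:
  assumes "\<And>x. x \<in> S \<Longrightarrow> \<exists>T. open T \<and> x \<in> T \<and> Ck_on k T f"
  shows "Ck_on k S f"
  using assms
proof (induction k arbitrary: f)
  case 0
  then show ?case
    by simp (metis continuous_at_imp_continuous_on continuous_on_eq_continuous_at)
next
  case (Suc k)
  show ?case
  proof (simp, intro conjI allI ballI)
    show "f differentiable at x" if "x \<in> S" for x
      using Suc.prems[OF that] by auto
    show "Ck_on k S (\<lambda>x. fd f x v)" for v
      by (rule Suc.IH) (use Suc.prems in force)
  qed
qed

lemma Ck_on_SucD: "Ck_on (Suc k) S f \<Longrightarrow> Ck_on k S f"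
proof (induction k arbitrary: f)
  case 0
  then show ?case
    by (simp add: continuous_at_imp_continuous_on differentiable_imp_continuous_within)
next
  case (Suc k)
  then show ?case by (metis Ck_on.simps(2))
qed

text \<open>Lets an explicit formula stand in for the chosen \<open>frechet_derivative\<close>; the
  closure properties below all induct through it.\<close>

lemma Ck_on_Suc_intro:
  assumes "\<And>x. x \<in> S \<Longrightarrow> (f has_derivative f' x) (at x)" "open S"
    and "\<And>v. Ck_on k S (\<lambda>x. f' x v)"
  shows "Ck_on (Suc k) S f"
proof -
  have "Ck_on k S (\<lambda>x. fd f x v)" for v
    by (rule Ck_on_cong[OF assms(2) _ assms(3)[of v]]) (use assms(1) fd_eqI in metis)
  then show ?thesis using assms(1) by (auto simp: differentiable_def)
qed

lemma Ck_on_Suc_has_derivative: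
  "Ck_on (Suc k) S f \<Longrightarrow> x \<in> S \<Longrightarrow> (f has_derivative fd f x) (at x)"
  by (simp add: fd_works)

section \<open>Closure properties of differentiability classes\<close>

lemma Ck_on_const: "open S \<Longrightarrow> Ck_on k S (\<lambda>x. c)"
proof (induction k arbitrary: c)
  case (Suc k)
  then show ?case by (intro Ck_on_Suc_intro[where f' = "\<lambda>x v. 0"]) auto
qed auto

lemma Ck_on_bounded_linear:
  assumes "bounded_linear h" "open S" "Ck_on k S f"
  shows "Ck_on k S (\<lambda>x. h (f x))"
  using assms(3)
proof (induction k arbitrary: f)
  case 0
  then show ?case using assms(1) by (simp add: linear_continuous_on_compose bounded_linear.linear)
next
  case (Suc k)
  then show ?case
    by (intro Ck_on_Suc_intro[where f' = "\<lambda>x v. h (fd f x v)"] assms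
        bounded_linear.has_derivative[OF assms(1)] Ck_on_Suc_has_derivative) auto
qed

lemma Ck_on_add:
  assumes "open S" "Ck_on k S f" "Ck_on k S g"
  shows "Ck_on k S (\<lambda>x. f x + g x)"
  using assms(2,3)
proof (induction k arbitrary: f g)
  case (Suc k)
  show ?case
  proof (rule Ck_on_Suc_intro[where f' = "\<lambda>x v. fd f x v + fd g x v"])
    show "((\<lambda>x. f x + g x) has_derivative (\<lambda>v. fd f x v + fd g x v)) (at x)" if "x \<in> S" for x
      using Suc.prems that by (intro has_derivative_add fd_works) auto
  qed (use Suc assms(1) in auto)
qed (auto intro: continuous_intros)

lemma Ck_on_sum:
  assumes "open S" "\<And>i. i \<in> I \<Longrightarrow> Ck_on k S (f i)"
  shows "Ck_on k S (\<lambda>x. \<Sum>i\<in>I. f i x)"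
  using assms(2)
  by (induction I rule: infinite_finite_induct) (auto intro: Ck_on_const Ck_on_add assms(1))

lemma Ck_on_bilinear:
  assumes "bounded_bilinear h" "open S" "Ck_on k S f" "Ck_on k S g"
  shows "Ck_on k S (\<lambda>x. h (f x) (g x))"
  using assms(3,4)
proof (induction k arbitrary: f g)
  case 0
  then show ?case using assms(1) by (simp add: bounded_bilinear.continuous_on)
next
  case (Suc k)
  show ?case
  proof (rule Ck_on_Suc_intro[where f' = "\<lambda>x v. h (f x) (fd g x v) + h (fd f x v) (g x)"])
    show "((\<lambda>x. h (f x) (g x)) has_derivative (\<lambda>v. h (f x) (fd g x v) + h (fd f x v) (g x))) (at x)"
      if "x \<in> S" for x
      by (intro bounded_bilinear.FDERIV[OF assms(1)] fd_works) (use Suc.prems that in auto)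
    show "Ck_on k S (\<lambda>x. h (f x) (fd g x v) + h (fd f x v) (g x))" for v
      using Suc.prems by (intro Ck_on_add Suc.IH assms(2)) (auto simp: Ck_on_SucD[OF Suc.prems(1)] Ck_on_SucD[OF Suc.prems(2)])
  qed (fact assms)
qed

lemmas Ck_on_scaleR = Ck_on_bilinear[OF bounded_bilinear_scaleR]
lemmas Ck_on_mult = Ck_on_bilinear[OF bounded_bilinear_mult]
lemmas Ck_on_inner_left = Ck_on_bounded_linear[OF bounded_linear_inner_left]

lemma linear_sum_Basis:
  fixes u :: "'a::euclidean_space"
  assumes "linear B"
  shows "B u = (\<Sum>i\<in>Basis. (u \<bullet> i) *\<^sub>R B i)"
proof -
  have "B u = B (\<Sum>i\<in>Basis. (u \<bullet> i) *\<^sub>R i)" by (simp add: euclidean_representation)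
  also have "\<dots> = (\<Sum>i\<in>Basis. (u \<bullet> i) *\<^sub>R B i)"
    using assms by (simp add: linear_sum linear_cmul)
  finally show ?thesis .
qed

text \<open>Smoothness of a family of linear maps is only ever known on fixed vectors. Expanding
  \<open>u x\<close> in the basis reduces the claim to finite sums of products.\<close>

lemma Ck_on_linear_apply:
  fixes u :: "'a::euclidean_space \<Rightarrow> 'c::euclidean_space" and B :: "'a \<Rightarrow> 'c \<Rightarrow> 'b::euclidean_space"
  assumes "open S" "\<And>x. x \<in> S \<Longrightarrow> linear (B x)" "\<And>i. i \<in> Basis \<Longrightarrow> Ck_on k S (\<lambda>x. B x i)"
    and "Ck_on k S u"
  shows "Ck_on k S (\<lambda>x. B x (u x))"
proof (rule Ck_on_cong[OF assms(1)])
  show "(\<Sum>i\<in>Basis. (u x \<bullet> i) *\<^sub>R B x i) = B x (u x)" if "x \<in> S" for x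
    by (rule linear_sum_Basis[OF assms(2)[OF that], symmetric])
  show "Ck_on k S (\<lambda>x. \<Sum>i\<in>Basis. (u x \<bullet> i) *\<^sub>R B x i)"
    by (intro Ck_on_sum Ck_on_scaleR Ck_on_inner_left assms)
qed

text \<open>Product rule for a family of linear maps, with the first term written as the derivative
  at a frozen argument. That is the shape in which derivatives of metric coefficients and of
  differentials occur later.\<close>

lemma has_derivative_linear_apply:
  fixes u :: "'a::euclidean_space \<Rightarrow> 'c::euclidean_space" and B :: "'a \<Rightarrow> 'c \<Rightarrow> 'b::euclidean_space"
  assumes "open S" "x \<in> S" "\<And>x. x \<in> S \<Longrightarrow> linear (B x)"
    and "\<And>i. i \<in> Basis \<Longrightarrow> (\<lambda>x. B x i) differentiable at x"
    and "(u has_derivative u') (at x)"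
  shows "((\<lambda>x. B x (u x)) has_derivative (\<lambda>w. fd (\<lambda>y. B y (u x)) x w + B x (u' w))) (at x)"
proof -
  have lin: "B y v = (\<Sum>i\<in>Basis. (v \<bullet> i) *\<^sub>R B y i)" if "y \<in> S" for y v
    using linear_sum_Basis[OF assms(3)[OF that]] .
  have d: "((\<lambda>x. B x i) has_derivative fd (\<lambda>x. B x i) x) (at x)" if "i \<in> Basis" for i
    using assms(4) that fd_works by blast
  have 1: "((\<lambda>y. \<Sum>i\<in>Basis. (v \<bullet> i) *\<^sub>R B y i) has_derivative
      (\<lambda>w. \<Sum>i\<in>Basis. (v \<bullet> i) *\<^sub>R fd (\<lambda>x. B x i) x w)) (at x)" for v
    by (intro has_derivative_sum has_derivative_scaleR_right d)
  have 2: "fd (\<lambda>y. B y v) x w = (\<Sum>i\<in>Basis. (v \<bullet> i) *\<^sub>R fd (\<lambda>x. B x i) x w)" for v w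
  proof -
    have "fd (\<lambda>y. B y v) x = fd (\<lambda>y. \<Sum>i\<in>Basis. (v \<bullet> i) *\<^sub>R B y i) x"
      by (rule fd_cong[OF assms(1,2) lin])
    then show ?thesis using fd_eqI[OF 1] by metis
  qed
  have "((\<lambda>y. \<Sum>i\<in>Basis. (u y \<bullet> i) *\<^sub>R B y i) has_derivative
      (\<lambda>w. \<Sum>i\<in>Basis. (u x \<bullet> i) *\<^sub>R fd (\<lambda>x. B x i) x w + (u' w \<bullet> i) *\<^sub>R B x i)) (at x)"
    by (intro has_derivative_sum has_derivative_scaleR d has_derivative_inner_left assms(5))
  then have "((\<lambda>x. B x (u x)) has_derivative
      (\<lambda>w. \<Sum>i\<in>Basis. (u x \<bullet> i) *\<^sub>R fd (\<lambda>x. B x i) x w + (u' w \<bullet> i) *\<^sub>R B x i)) (at x)"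
    by (rule has_derivative_transform_within_open[OF _ assms(1,2)]) (simp add: lin)
  moreover have "(\<lambda>w. \<Sum>i\<in>Basis. (u x \<bullet> i) *\<^sub>R fd (\<lambda>x. B x i) x w + (u' w \<bullet> i) *\<^sub>R B x i) =
      (\<lambda>w. fd (\<lambda>y. B y (u x)) x w + B x (u' w))"
    by (rule ext) (simp only: 2[of "u x"] sum.distrib lin[OF assms(2), of "u' _"])
  ultimately show ?thesis by simp
qed

lemma linear_fd: "f differentiable at x \<Longrightarrow> linear (fd f x)"
  by (rule linear_frechet_derivative)

lemma Ck_on_fd:
  assumes "open S" "Ck_on (Suc k) S f" "Ck_on k S u"
  shows "Ck_on k S (\<lambda>x. fd f x (u x))"
  by (rule Ck_on_linear_apply) (use assms linear_fd in auto)

text \<open>The chain rule presents the derivative as the linear map \<open>fd g (f x)\<close>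
  applied to \<open>fd f x v\<close>. The induction hypothesis is needed for the directional
  derivatives of \<open>g\<close> along the same \<open>f\<close>, so only \<open>g\<close> is
  generalised.\<close>

lemma Ck_on_compose:
  assumes "open S" "open T" "f ` S \<subseteq> T" "Ck_on k S f" "Ck_on k T g"
  shows "Ck_on k S (\<lambda>x. g (f x))"
  using assms(4,5)
proof (induction k arbitrary: g)
  case 0
  then show ?case using assms(3) by simp (metis continuous_on_compose2)
next
  case (Suc k)
  show ?case
  proof (rule Ck_on_Suc_intro[where f' = "\<lambda>x v. fd g (f x) (fd f x v)"])
    have g: "g differentiable at (f x)" if "x \<in> S" for x
      using Suc.prems(2) that assms(3) by auto
    show "((\<lambda>x. g (f x)) has_derivative (\<lambda>v. fd g (f x) (fd f x v))) (at x)" if "x \<in> S" for x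
      using diff_chain_at[of f "fd f x" x g "fd g (f x)"] g[OF that] that Suc.prems(1)
      by (simp add: o_def fd_works)
    show "Ck_on k S (\<lambda>x. fd g (f x) (fd f x v))" for v
    proof (rule Ck_on_linear_apply[OF assms(1), where B = "\<lambda>x. fd g (f x)"])
      show "linear (fd g (f x))" if "x \<in> S" for x using g that linear_fd by blast
      show "Ck_on k S (\<lambda>x. fd g (f x) i)" if "i \<in> Basis" for i
        by (rule Suc.IH[of "\<lambda>y. fd g y i"]) (use Suc.prems Ck_on_SucD[of k S f] in auto)
      show "Ck_on k S (\<lambda>x. fd f x v)" using Suc.prems by simp
    qed
  qed (fact assms)
qed

section \<open>Smooth maps, and product rules for families of bilinear forms\<close>

lemma smooth_onD: "smooth_on S f \<Longrightarrow> Ck_on k S f"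
  by (simp add: smooth_on_def)

lemma smooth_on_differentiable: "smooth_on S f \<Longrightarrow> x \<in> S \<Longrightarrow> f differentiable at x"
  using smooth_onD[of S f "Suc 0"] by auto

lemma smooth_on_subset: "smooth_on S f \<Longrightarrow> T \<subseteq> S \<Longrightarrow> smooth_on T f"
  unfolding smooth_on_def by (metis Ck_on_subset)

lemma smooth_on_cong:
  "open S \<Longrightarrow> (\<And>x. x \<in> S \<Longrightarrow> f x = g x) \<Longrightarrow> smooth_on S f \<Longrightarrow> smooth_on S g"
  unfolding smooth_on_def using Ck_on_cong[of S f g] by simp

lemma smooth_on_locally:
  assumes "\<And>x. x \<in> S \<Longrightarrow> \<exists>T. open T \<and> x \<in> T \<and> smooth_on T f"
  shows "smooth_on S f"
  unfolding smooth_on_def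
proof (intro allI Ck_on_locally)
  fix k x assume "x \<in> S"
  then show "\<exists>T. open T \<and> x \<in> T \<and> Ck_on k T f"
    using assms smooth_onD by blast
qed

lemma smooth_on_const: "open S \<Longrightarrow> smooth_on S (\<lambda>x. c)"
  by (simp add: smooth_on_def Ck_on_const)

lemma smooth_on_add:
  "open S \<Longrightarrow> smooth_on S f \<Longrightarrow> smooth_on S g \<Longrightarrow> smooth_on S (\<lambda>x. f x + g x)"
  by (simp add: smooth_on_def Ck_on_add)

lemma smooth_on_mult:
  fixes f g :: "_ \<Rightarrow> real"
  shows "open S \<Longrightarrow> smooth_on S f \<Longrightarrow> smooth_on S g \<Longrightarrow> smooth_on S (\<lambda>x. f x * g x)"
  by (simp add: smooth_on_def Ck_on_mult)

lemma smooth_on_linear_apply: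
  fixes u :: "'a::euclidean_space \<Rightarrow> 'c::euclidean_space" and B :: "'a \<Rightarrow> 'c \<Rightarrow> 'b::euclidean_space"
  assumes "open S" "\<And>x. x \<in> S \<Longrightarrow> linear (B x)" "\<And>i. i \<in> Basis \<Longrightarrow> smooth_on S (\<lambda>x. B x i)"
    and "smooth_on S u"
  shows "smooth_on S (\<lambda>x. B x (u x))"
  using assms Ck_on_linear_apply[of S B _ u] by (simp add: smooth_on_def)

lemma smooth_on_fd:
  "open S \<Longrightarrow> smooth_on S f \<Longrightarrow> smooth_on S u \<Longrightarrow> smooth_on S (\<lambda>x. fd f x (u x))"
  by (simp add: smooth_on_def Ck_on_fd)

lemma smooth_on_compose:
  "open S \<Longrightarrow> open T \<Longrightarrow> f ` S \<subseteq> T \<Longrightarrow> smooth_on S f \<Longrightarrow> smooth_on T g \<Longrightarrow> smooth_on S (\<lambda>x. g (f x))"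
  by (simp add: smooth_on_def Ck_on_compose)

lemma smooth_on_continuous_on: "smooth_on S f \<Longrightarrow> continuous_on S f"
  using smooth_onD[of S f 0] by simp

lemma bilinear_linear_left: "bilinear b \<Longrightarrow> linear (\<lambda>u. b u v)"
  and bilinear_linear_right: "bilinear b \<Longrightarrow> linear (b u)"
  by (simp_all add: bilinear_def)

lemma smooth_on_bilinear_apply:
  fixes a b :: "'a::euclidean_space \<Rightarrow> 'c::euclidean_space" and G :: "'a \<Rightarrow> 'c \<Rightarrow> 'c \<Rightarrow> real"
  assumes "open S" "\<And>x. x \<in> S \<Longrightarrow> bilinear (G x)" "\<And>i j. smooth_on S (\<lambda>x. G x i j)"
    and "smooth_on S a" "smooth_on S b"
  shows "smooth_on S (\<lambda>x. G x (a x) (b x))"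
proof (rule smooth_on_linear_apply[OF assms(1), where B = "\<lambda>x v. G x v (b x)"])
  show "smooth_on S (\<lambda>x. G x i (b x))" for i
    by (rule smooth_on_linear_apply[OF assms(1), where B = "\<lambda>x. G x i"])
      (use assms in \<open>auto intro: bilinear_linear_right\<close>)
qed (use assms in \<open>auto intro: bilinear_linear_left\<close>)

lemma has_derivative_bilinear_apply:
  fixes a b :: "'a::euclidean_space \<Rightarrow> 'c::euclidean_space" and G :: "'a \<Rightarrow> 'c \<Rightarrow> 'c \<Rightarrow> real"
  assumes S: "open S" "x \<in> S" and G: "\<And>x. x \<in> S \<Longrightarrow> bilinear (G x)"
    "\<And>i j. (\<lambda>x. G x i j) differentiable at x"
    and a: "(a has_derivative a') (at x)" and b: "(b has_derivative b') (at x)"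
  shows "((\<lambda>x. G x (a x) (b x)) has_derivative
    (\<lambda>w. fd (\<lambda>y. G y (a x) (b x)) x w + G x (a' w) (b x) + G x (a x) (b' w))) (at x)"
proof -
  have 1: "((\<lambda>y. G y i (b y)) has_derivative (\<lambda>w. fd (\<lambda>y. G y i (b x)) x w + G x i (b' w))) (at x)" for i
    by (rule has_derivative_linear_apply[OF S _ _ b, where B = "\<lambda>y. G y i"])
      (use G in \<open>auto intro: bilinear_linear_right\<close>)
  have 2: "((\<lambda>y. G y (a y) (b y)) has_derivative
      (\<lambda>w. fd (\<lambda>y. G y (a x) (b y)) x w + G x (a' w) (b x))) (at x)"
  proof (rule has_derivative_linear_apply[OF S _ _ a, where B = "\<lambda>y v. G y v (b y)"])
    show "(\<lambda>y. G y i (b y)) differentiable at x" for i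
      using 1 by (auto simp: differentiable_def)
  qed (use G in \<open>auto intro: bilinear_linear_left\<close>)
  \<comment> \<open>The derivative with only \<open>a\<close> frozen still sees \<open>b\<close>
    vary; by fact 1 this variation is the last term.\<close>
  have 3: "(\<lambda>w. fd (\<lambda>y. G y (a x) (b y)) x w + G x (a' w) (b x)) =
    (\<lambda>w. fd (\<lambda>y. G y (a x) (b x)) x w + G x (a' w) (b x) + G x (a x) (b' w))"
    by (rule ext) (simp add: fd_eqI[OF 1])
  show ?thesis using 2 unfolding 3 .
qed

text \<open>The second difference of \<open>g\<close> over a small parallelogram is \<open>h\<^sup>2\<close> times a mixed second
  derivative at a nearby point, for either order of differentiation.\<close>

lemma second_difference_mvt:
  fixes g :: "'a::euclidean_space \<Rightarrow> real"
  assumes "Ck_on (Suc (Suc 0)) S g" "0 < h"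
    and in_S: "\<And>s t. 0 \<le> s \<Longrightarrow> s \<le> h \<Longrightarrow> 0 \<le> t \<Longrightarrow> t \<le> h \<Longrightarrow> x + s *\<^sub>R u + t *\<^sub>R v \<in> S"
  obtains s t where "0 \<le> s" "s \<le> h" "0 \<le> t" "t \<le> h"
    "g (x + h *\<^sub>R u + h *\<^sub>R v) - g (x + h *\<^sub>R u) - g (x + h *\<^sub>R v) + g x
      = h * h * fd (\<lambda>y. fd g y u) (x + s *\<^sub>R u + t *\<^sub>R v) v"
proof -
  let ?p = "\<lambda>s t. x + s *\<^sub>R u + t *\<^sub>R v"
  have dg: "(g has_derivative fd g (?p s t)) (at (?p s t))"
    if "0 \<le> s" "s \<le> h" "0 \<le> t" "t \<le> h" for s t
    using assms(1) in_S[OF that] by (intro fd_works) auto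
  have dgu: "((\<lambda>y. fd g y u) has_derivative fd (\<lambda>y. fd g y u) (?p s t)) (at (?p s t))"
    if "0 \<le> s" "s \<le> h" "0 \<le> t" "t \<le> h" for s t
    using assms(1) in_S[OF that] by (intro fd_works) auto
  have ds: "((\<lambda>s. g (?p s t)) has_real_derivative fd g (?p s t) u) (at s)"
    if "0 \<le> s" "s \<le> h" "0 \<le> t" "t \<le> h" for s t
  proof -
    have "((\<lambda>s. ?p s t) has_derivative (\<lambda>k. k *\<^sub>R u)) (at s)"
      by (auto intro!: derivative_eq_intros)
    from diff_chain_at[OF this dg[OF that]]
    show ?thesis
      using linear_cmul[OF has_derivative_linear[OF dg[OF that]]]
      by (simp add: o_def has_field_derivative_def mult_commute_abs)
  qed
  have dt: "((\<lambda>t. fd g (?p s t) u) has_real_derivative fd (\<lambda>y. fd g y u) (?p s t) v) (at t)"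
    if "0 \<le> s" "s \<le> h" "0 \<le> t" "t \<le> h" for s t
  proof -
    have "((\<lambda>t. ?p s t) has_derivative (\<lambda>k. k *\<^sub>R v)) (at t)"
      by (auto intro!: derivative_eq_intros)
    from diff_chain_at[OF this dgu[OF that]]
    show ?thesis
      using linear_cmul[OF has_derivative_linear[OF dgu[OF that]]]
      by (simp add: o_def has_field_derivative_def mult_commute_abs)
  qed
  \<comment> \<open>The second difference is the increment in \<open>s\<close> of the difference
    between the edges \<open>t = h\<close> and \<open>t = 0\<close>; a further mean value step in
    \<open>t\<close> then yields the mixed derivative.\<close>
  have "\<exists>z. 0 < z \<and> z < h \<and>
      (g (?p h h) - g (?p h 0)) - (g (?p 0 h) - g (?p 0 0)) = (h - 0) * (fd g (?p z h) u - fd g (?p z 0) u)"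
    by (rule MVT2[OF assms(2), where f = "\<lambda>s. g (?p s h) - g (?p s 0)"])
      (use ds[where t = h] ds[where t = 0] assms(2) in \<open>auto intro!: DERIV_diff\<close>)
  then obtain s where s: "0 < s" "s < h"
    "(g (?p h h) - g (?p h 0)) - (g (?p 0 h) - g (?p 0 0)) = h * (fd g (?p s h) u - fd g (?p s 0) u)"
    by auto
  have "\<exists>z. 0 < z \<and> z < h \<and> fd g (?p s h) u - fd g (?p s 0) u = (h - 0) * fd (\<lambda>y. fd g y u) (?p s z) v"
    by (rule MVT2[OF assms(2), where f = "\<lambda>t. fd g (?p s t) u"]) (use dt s in auto)
  then obtain t where "0 < t" "t < h"
    "fd g (?p s h) u - fd g (?p s 0) u = h * fd (\<lambda>y. fd g y u) (?p s t) v"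
    by auto
  with s show ?thesis by (intro that[of s t]) auto
qed

text \<open>Exchanging \<open>u\<close> and \<open>v\<close> leaves the second difference unchanged,
  so the two mixed derivatives agree at points arbitrarily close to \<open>x\<close>. Continuity
  carries this over to \<open>x\<close> itself.\<close>

lemma mixed_derivatives_real:
  fixes g :: "'a::euclidean_space \<Rightarrow> real"
  assumes S: "open S" "x \<in> S" and g: "Ck_on (Suc (Suc 0)) S g"
  shows "fd (\<lambda>y. fd g y u) x v = fd (\<lambda>y. fd g y v) x u"
proof (rule ccontr)
  assume neq: "\<not> ?thesis"
  \<comment> \<open>Half the supposed gap: no number can be within \<open>e\<close> of both
    values.\<close>
  define e where "e = dist (fd (\<lambda>y. fd g y u) x v) (fd (\<lambda>y. fd g y v) x u) / 2"
  have e: "e > 0" using neq by (simp add: e_def)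
  have "continuous_on S (\<lambda>y. fd (\<lambda>y. fd g y a) y b)" for a b
    using g by simp
  then have "continuous (at x) (\<lambda>y. fd (\<lambda>y. fd g y a) y b)" for a b
    using S by (simp add: continuous_on_eq_continuous_at)
  then have c: "\<exists>d>0. \<forall>y. dist y x < d \<longrightarrow>
      dist (fd (\<lambda>y. fd g y a) y b) (fd (\<lambda>y. fd g y a) x b) < e" for a b
    using e unfolding continuous_at_eps_delta by blast
  obtain d1 where d1: "d1 > 0" "\<And>y. dist y x < d1 \<Longrightarrow>
      dist (fd (\<lambda>y. fd g y u) y v) (fd (\<lambda>y. fd g y u) x v) < e" using c by blast
  obtain d2 where d2: "d2 > 0" "\<And>y. dist y x < d2 \<Longrightarrow>
      dist (fd (\<lambda>y. fd g y v) y u) (fd (\<lambda>y. fd g y v) x u) < e" using c by blast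
  obtain d3 where d3: "d3 > 0" "\<And>y. dist y x < d3 \<Longrightarrow> y \<in> S"
    using S unfolding open_dist by blast
  define d where "d = min d1 (min d2 d3)"
  \<comment> \<open>Small enough to keep the whole parallelogram in the ball of radius
    \<open>d\<close>; the summand 1 keeps the denominator positive when
    \<open>u = v = 0\<close>.\<close>
  define h where "h = d / (2 * (norm u + norm v + 1))"
  have d: "d > 0" using d1 d2 d3 by (simp add: d_def)
  have h: "h > 0"
    using d norm_ge_zero[of u] norm_ge_zero[of v] by (simp add: h_def add_nonneg_pos)
  have hd: "h * (norm u + norm v + 1) < d"
  proof -
    have "norm u + norm v + 1 > 0" by (simp add: add_nonneg_pos)
    then have "h * (norm u + norm v + 1) = d / 2" by (simp add: h_def field_simps)
    then show ?thesis using d by simp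
  qed
  \<comment> \<open>The condition on the norms covers the parallelogram in both orders,
    \<open>(u, v)\<close> and \<open>(v, u)\<close>.\<close>
  have near: "dist (x + s *\<^sub>R a + t *\<^sub>R b) x < d"
    if "0 \<le> s" "s \<le> h" "0 \<le> t" "t \<le> h" "norm a + norm b = norm u + norm v" for s t and a b :: 'a
  proof -
    have "dist (x + s *\<^sub>R a + t *\<^sub>R b) x = norm (s *\<^sub>R a + t *\<^sub>R b)"
      by (simp add: dist_norm algebra_simps)
    also have "\<dots> \<le> s * norm a + t * norm b"
      using that norm_triangle_ineq[of "s *\<^sub>R a" "t *\<^sub>R b"] by simp
    also have "\<dots> \<le> h * norm a + h * norm b"
      using that by (intro add_mono mult_right_mono) auto
    also have "\<dots> = h * (norm u + norm v)" using that(5) by (simp add: distrib_left[symmetric])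
    also have "\<dots> < d" using hd h by (simp add: algebra_simps)
    finally show ?thesis .
  qed
  obtain s t where st: "0 \<le> s" "s \<le> h" "0 \<le> t" "t \<le> h"
    "g (x + h *\<^sub>R u + h *\<^sub>R v) - g (x + h *\<^sub>R u) - g (x + h *\<^sub>R v) + g x
      = h * h * fd (\<lambda>y. fd g y u) (x + s *\<^sub>R u + t *\<^sub>R v) v"
    by (rule second_difference_mvt[OF g h, of x u v]) (use near d3(2) d_def in auto)
  obtain s' t' where st': "0 \<le> s'" "s' \<le> h" "0 \<le> t'" "t' \<le> h"
    "g (x + h *\<^sub>R v + h *\<^sub>R u) - g (x + h *\<^sub>R v) - g (x + h *\<^sub>R u) + g x
      = h * h * fd (\<lambda>y. fd g y v) (x + s' *\<^sub>R v + t' *\<^sub>R u) u"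
    by (rule second_difference_mvt[OF g h, of x v u]) (use near d3(2) d_def in auto)
  have "h * h * fd (\<lambda>y. fd g y u) (x + s *\<^sub>R u + t *\<^sub>R v) v
      = h * h * fd (\<lambda>y. fd g y v) (x + s' *\<^sub>R v + t' *\<^sub>R u) u"
    using st(5) st'(5) by (simp add: algebra_simps)
  then have "fd (\<lambda>y. fd g y u) (x + s *\<^sub>R u + t *\<^sub>R v) v
      = fd (\<lambda>y. fd g y v) (x + s' *\<^sub>R v + t' *\<^sub>R u) u"
    using h by simp
  moreover have "dist (fd (\<lambda>y. fd g y u) (x + s *\<^sub>R u + t *\<^sub>R v) v) (fd (\<lambda>y. fd g y u) x v) < e"
    using near[OF st(1-4), of u v] by (intro d1) (simp add: d_def)
  moreover have "dist (fd (\<lambda>y. fd g y v) (x + s' *\<^sub>R v + t' *\<^sub>R u) u) (fd (\<lambda>y. fd g y v) x u) < e"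
    using near[OF st'(1-4), of v u] by (intro d2) (simp add: d_def)
  ultimately show False
    unfolding e_def dist_real_def by argo
qed

lemma mixed_derivatives:
  fixes f :: "'a::euclidean_space \<Rightarrow> 'b::euclidean_space"
  assumes S: "open S" "x \<in> S" and f: "Ck_on (Suc (Suc 0)) S f"
  shows "fd (\<lambda>y. fd f y u) x v = fd (\<lambda>y. fd f y v) x u"
proof (rule euclidean_eqI)
  fix i :: 'b assume "i \<in> Basis"
  have 1: "fd (\<lambda>y. f y \<bullet> i) y a = fd f y a \<bullet> i" if "y \<in> S" for y a
    using fd_eqI[OF has_derivative_inner_left[OF Ck_on_Suc_has_derivative[OF f that]]] by simp
  have 2: "fd (\<lambda>y. fd (\<lambda>y. f y \<bullet> i) y a) x b = fd (\<lambda>y. fd f y a) x b \<bullet> i" for a b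
  proof -
    have "Ck_on (Suc 0) S (\<lambda>y. fd f y a)" using f by simp
    from fd_eqI[OF has_derivative_inner_left[OF Ck_on_Suc_has_derivative[OF this S(2)]]]
    have "fd (\<lambda>y. fd f y a \<bullet> i) x b = fd (\<lambda>y. fd f y a) x b \<bullet> i" by simp
    moreover have "fd (\<lambda>y. fd (\<lambda>y. f y \<bullet> i) y a) x = fd (\<lambda>y. fd f y a \<bullet> i) x"
      by (rule fd_cong[OF S]) (rule 1)
    ultimately show ?thesis by simp
  qed
  have "Ck_on (Suc (Suc 0)) S (\<lambda>y. f y \<bullet> i)"
    using Ck_on_inner_left[OF S(1) f] .
  from mixed_derivatives_real[OF S this, of u v] 2
  show "fd (\<lambda>y. fd f y u) x v \<bullet> i = fd (\<lambda>y. fd f y v) x u \<bullet> i" by simp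
qed

section \<open>Lorentzian forms and the Koszul formula\<close>

text \<open>Pairing with \<open>u\<close> recovers the coefficient of \<open>u\<close> in
  \<open>s\<close>, so \<open>b s s\<close> is the sum of the squared coefficients.\<close>

lemma orthonormal_definite:
  assumes b: "bilinear b" and B: "finite B" "\<And>u. u \<in> B \<Longrightarrow> b u u = (1::real)"
    "\<And>u v. u \<in> B \<Longrightarrow> v \<in> B \<Longrightarrow> u \<noteq> v \<Longrightarrow> b u v = 0" and s: "s \<in> span B"
  shows "b s s \<ge> 0" "b s s = 0 \<Longrightarrow> s = 0"
proof -
  obtain r where r: "s = (\<Sum>u\<in>B. r u *\<^sub>R u)"
    using s unfolding span_finite[OF B(1)] by auto
  have lin1: "linear (\<lambda>x. b x y)" and lin2: "linear (b x)" for x y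
    using b by (auto simp: bilinear_def)
  have 1: "b u s = r u" if u: "u \<in> B" for u
  proof -
    have "b u s = (\<Sum>v\<in>B. r v * b u v)"
      unfolding r by (simp add: linear_sum[OF lin2] linear_cmul[OF lin2])
    also have "\<dots> = (\<Sum>v\<in>B. if v = u then r u else 0)"
      using B u by (intro sum.cong) auto
    finally show ?thesis using B(1) u by simp
  qed
  have "b s s = b (\<Sum>u\<in>B. r u *\<^sub>R u) s" using r by simp
  also have "\<dots> = (\<Sum>u\<in>B. r u * b u s)"
    by (simp add: linear_sum[OF lin1] linear_cmul[OF lin1])
  also have "\<dots> = (\<Sum>u\<in>B. (r u)\<^sup>2)"
    using 1 by (intro sum.cong) (auto simp: power2_eq_square)
  finally have eq: "b s s = (\<Sum>u\<in>B. (r u)\<^sup>2)" .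
  show "b s s \<ge> 0" unfolding eq by (simp add: sum_nonneg)
  assume "b s s = 0"
  then have "\<forall>u\<in>B. (r u)\<^sup>2 = 0" unfolding eq using B(1) by (subst (asm) sum_nonneg_eq_0_iff) auto
  then show "s = 0" unfolding r by simp
qed

text \<open>\<open>S\<close> is the span of the spacelike members of the basis. The later arguments
  need only this splitting into a timelike line and a definite orthogonal complement.\<close>

lemma lorentzian_split:
  assumes "bilinear b" "\<And>u v. b u v = b v u" "lorentzian_form b"
  shows "\<exists>t S. b t t = -1 \<and> subspace S \<and>
    (\<forall>s\<in>S. b t s = 0 \<and> b s s \<ge> 0 \<and> (b s s = 0 \<longrightarrow> s = 0)) \<and> (\<forall>v. \<exists>a s. s \<in> S \<and> v = a *\<^sub>R t + s)"
proof -
  obtain B t where B: "independent B" "span B = UNIV" "t \<in> B" "b t t = -1"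
    "\<And>u. u \<in> B - {t} \<Longrightarrow> b u u = 1" "\<And>u v. u \<in> B \<Longrightarrow> v \<in> B \<Longrightarrow> u \<noteq> v \<Longrightarrow> b u v = 0"
    using assms(3) unfolding lorentzian_form_def by auto
  have fin: "finite (B - {t})" using independent_imp_finite[OF B(1)] by simp
  have orth: "b t s = 0" if "s \<in> span (B - {t})" for s
    using that
  proof (induction rule: span_induct)
    case base
    then show ?case
      using assms(1) by (auto simp: subspace_def bilinear_radd bilinear_rmul bilinear_rzero)
  qed (use B in auto)
  have split: "\<exists>a s. s \<in> span (B - {t}) \<and> v = a *\<^sub>R t + s" for v
  proof -
    have "v \<in> span (insert t (B - {t}))" using B(2,3) by (simp add: insert_absorb)
    then obtain a where "v - a *\<^sub>R t \<in> span (B - {t})" using span_breakdown_eq by blast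
    then show ?thesis by (intro exI[of _ a] exI[of _ "v - a *\<^sub>R t"]) auto
  qed
  have def: "b s s \<ge> 0" "b s s = 0 \<Longrightarrow> s = 0" if "s \<in> span (B - {t})" for s
    using orthonormal_definite[OF assms(1) fin _ _ that] B by auto
  show ?thesis
    by (intro exI[of _ t] exI[of _ "span (B - {t})"]) (use B(4) orth split def in auto)
qed

text \<open>Pairing with \<open>t\<close> kills the timelike coefficient of \<open>u\<close>;
  pairing the rest with itself kills it by definiteness on \<open>S\<close>.\<close>

lemma lorentzian_nondegenerate:
  assumes b: "bilinear b" "\<And>u v. b u v = b v u" "lorentzian_form b" and u: "\<And>v. b u v = 0"
  shows "u = 0"
proof -
  obtain t S where S: "b t t = -1" "\<forall>s\<in>S. b t s = 0" "\<forall>s\<in>S. b s s = 0 \<longrightarrow> s = 0"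
    "\<forall>v. \<exists>a s. s \<in> S \<and> v = a *\<^sub>R t + s"
    using lorentzian_split[OF b] by blast
  obtain a s where as: "s \<in> S" "u = a *\<^sub>R t + s" using S(4) by blast
  have "b u t = - a" using as S(1,2) b(2)[of s t]
    by (simp add: bilinear_ladd[OF b(1)] bilinear_lmul[OF b(1)])
  then have "a = 0" using u by simp
  then have "b s s = 0" using u[of s] as by simp
  then show ?thesis using S(3) as \<open>a = 0\<close> by simp
qed

text \<open>Subtracting a multiple of the null vector \<open>n\<close> makes \<open>w\<close> spacelike without changing
  \<open>b w w\<close>.\<close>

lemma lorentzian_null_perp:
  assumes b: "bilinear b" "\<And>u v. b u v = b v u" "lorentzian_form b"
    and n: "n \<noteq> 0" "b n n = 0" "b n w = 0"
  shows "b w w \<ge> 0" "b w w = 0 \<Longrightarrow> \<exists>c. w = c *\<^sub>R n"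
proof -
  obtain t S where S: "subspace S" "\<forall>s\<in>S. b s s \<ge> 0" "\<forall>s\<in>S. b s s = 0 \<longrightarrow> s = 0"
    "\<forall>v. \<exists>a s. s \<in> S \<and> v = a *\<^sub>R t + s"
    using lorentzian_split[OF b] by blast
  obtain a s where n': "s \<in> S" "n = a *\<^sub>R t + s" using S(4) by blast
  obtain c r where w': "r \<in> S" "w = c *\<^sub>R t + r" using S(4) by blast
  \<comment> \<open>Otherwise \<open>n\<close> would be a null vector in the definite space
    \<open>S\<close>, hence zero.\<close>
  have "a \<noteq> 0" using n n' S(3) by auto
  \<comment> \<open>The multiple for which the timelike part of \<open>w - k *\<^sub>R n\<close>
    cancels.\<close>
  define k where "k = c / a"
  have eq: "w - k *\<^sub>R n = r - k *\<^sub>R s" using n'(2) w'(2) \<open>a \<noteq> 0\<close> by (simp add: k_def algebra_simps)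
  then have in_S: "w - k *\<^sub>R n \<in> S" unfolding eq using n'(1) w'(1) S(1) by (simp add: subspace_diff subspace_scale)
  have "b (w - k *\<^sub>R n) (w - k *\<^sub>R n) = b w w"
    using n b(2)[of w n]
    by (simp add: bilinear_lsub[OF b(1)] bilinear_rsub[OF b(1)] bilinear_lmul[OF b(1)]
        bilinear_rmul[OF b(1)])
  then show "b w w \<ge> 0" "b w w = 0 \<Longrightarrow> \<exists>c. w = c *\<^sub>R n"
    using S(2,3) in_S by (auto intro: exI[of _ k])
qed

text \<open>\<open>R\<close> raises an index: it inverts the map sending \<open>u\<close> to the
  Euclidean vector that represents \<open>b u\<close>, which is injective by nondegeneracy and hence
  bijective in finite dimension.\<close>

lemma nondegenerate_represent:
  fixes b :: "'e::euclidean_space \<Rightarrow> 'e \<Rightarrow> real"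
  assumes b: "bilinear b" "\<And>u. (\<And>v. b u v = 0) \<Longrightarrow> u = 0"
  obtains R where "linear R" "\<And>a v. b (R a) v = a \<bullet> v"
proof -
  define A where "A = (\<lambda>u. \<Sum>i\<in>Basis. b u i *\<^sub>R i)"
  have A: "A u \<bullet> v = b u v" for u v
  proof -
    have "b u v = (\<Sum>i\<in>Basis. (v \<bullet> i) *\<^sub>R b u i)"
      by (rule linear_sum_Basis) (use b(1) in \<open>simp add: bilinear_def\<close>)
    then show ?thesis by (simp add: A_def inner_sum_left inner_commute[of v] mult.commute[of "_ \<bullet> v"])
  qed
  have lin: "linear A"
    by (intro linearI) (simp_all add: A_def bilinear_ladd[OF b(1)] bilinear_lmul[OF b(1)]
        scaleR_add_left sum.distrib scaleR_sum_right)
  have "inj A"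
  proof (rule linear_injective_0[OF lin, THEN iffD2], intro allI impI)
    fix u assume "A u = 0"
    then have "b u v = 0" for v using A[of u v] by simp
    then show "u = 0" by (rule b(2))
  qed
  then have "bij A" using linear_injective_imp_surjective[OF lin] by (simp add: bij_def)
  show ?thesis
  proof (rule that[of "inv A"])
    show "linear (inv A)"
    proof (rule linearI)
      show "inv A (x + y) = inv A x + inv A y" for x y
        using \<open>bij A\<close> linear_add[OF lin, of "inv A x" "inv A y"]
        by (metis bij_inv_eq_iff)
      show "inv A (c *\<^sub>R x) = c *\<^sub>R inv A x" for c x
        using \<open>bij A\<close> linear_cmul[OF lin, of c "inv A x"] by (metis bij_inv_eq_iff)
    qed
    show "b (inv A a) v = a \<bullet> v" for a v
      using A[of "inv A a" v] \<open>bij A\<close> by (simp add: bij_is_surj surj_f_inv_f)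
  qed
qed

text \<open>The fundamental lemma of Riemannian geometry at one point, with \<open>D w u v\<close>
  in the role of the derivative of the metric coefficients.\<close>

lemma koszul:
  fixes b :: "'e::euclidean_space \<Rightarrow> 'e \<Rightarrow> real" and D :: "'e \<Rightarrow> 'e \<Rightarrow> 'e \<Rightarrow> real"
  assumes b: "bilinear b" "\<And>u v. b u v = b v u" "\<And>u. (\<And>v. b u v = 0) \<Longrightarrow> u = 0"
    and D: "\<And>u v. linear (\<lambda>w. D w u v)" "\<And>w v. linear (\<lambda>u. D w u v)" "\<And>w u v. D w u v = D w v u"
  shows "\<exists>!\<Gamma>. bilinear \<Gamma> \<and> (\<forall>u v. \<Gamma> u v = \<Gamma> v u) \<and>
    (\<forall>w u v. D w u v = b (\<Gamma> w u) v + b u (\<Gamma> w v))"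
proof (rule ex_ex1I)
  obtain R where R: "linear R" "\<And>a v. b (R a) v = a \<bullet> v"
    using nondegenerate_represent[OF b(1,3)] by blast
  have D3: "linear (\<lambda>v. D w u v)" for w u using D(2)[of w u] D(3) by simp
  note l = D(1,2) D3
  \<comment> \<open>The Christoffel symbols of the first kind; raising their last index with
    \<open>R\<close> gives \<open>\<Gamma>\<close>.\<close>
  define K where "K = (\<lambda>w u v. (D w u v + D u w v - D v w u) / 2)"
  define \<Gamma> where "\<Gamma> = (\<lambda>w u. R (\<Sum>i\<in>Basis. K w u i *\<^sub>R i))"
  have bl: "b (\<Gamma> w u) v = K w u v" for w u v
  proof -
    have "linear (K w u)"
      by (rule linearI) (simp_all add: K_def linear_add[OF l(1)] linear_add[OF l(2)] linear_add[OF l(3)]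
          linear_cmul[OF l(1)] linear_cmul[OF l(2)] linear_cmul[OF l(3)] algebra_simps add_divide_distrib diff_divide_distrib)
    then have "K w u v = (\<Sum>i\<in>Basis. (v \<bullet> i) *\<^sub>R K w u i)" by (rule linear_sum_Basis)
    then show ?thesis by (simp add: \<Gamma>_def R inner_sum_left inner_commute[of v] mult.commute[of "_ \<bullet> v"])
  qed
  have sym: "\<Gamma> u v = \<Gamma> v u" for u v by (simp add: \<Gamma>_def K_def D(3)[of _ u v] add.commute)
  have lin: "linear (\<lambda>w. \<Gamma> w u)" for u
  proof (rule linearI)
    have K: "K (w + w') u i = K w u i + K w' u i" "K (c *\<^sub>R w) u i = c * K w u i" for w w' i c
      by (simp_all add: K_def linear_add[OF l(1)] linear_add[OF l(2)] linear_add[OF l(3)]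
          linear_cmul[OF l(1)] linear_cmul[OF l(2)] linear_cmul[OF l(3)] algebra_simps add_divide_distrib diff_divide_distrib)
    show "\<Gamma> (w + w') u = \<Gamma> w u + \<Gamma> w' u" for w w'
      by (simp add: \<Gamma>_def K scaleR_add_left sum.distrib linear_add[OF R(1)])
    show "\<Gamma> (c *\<^sub>R w) u = c *\<^sub>R \<Gamma> w u" for c w
      by (simp add: \<Gamma>_def K linear_cmul[OF R(1), symmetric] scaleR_sum_right)
  qed
  have "bilinear \<Gamma>" using lin sym by (simp add: bilinear_def)
  moreover have "D w u v = b (\<Gamma> w u) v + b u (\<Gamma> w v)" for w u v
    unfolding b(2)[of u] bl by (simp add: K_def D(3)[of w v u] D(3)[of v w u] D(3)[of u v w] field_simps)
  ultimately show "\<exists>\<Gamma>. bilinear \<Gamma> \<and> (\<forall>u v. \<Gamma> u v = \<Gamma> v u) \<and>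
      (\<forall>w u v. D w u v = b (\<Gamma> w u) v + b u (\<Gamma> w v))"
    using sym by blast
next
  fix \<Gamma> \<Gamma>'
  assume 1: "bilinear \<Gamma> \<and> (\<forall>u v. \<Gamma> u v = \<Gamma> v u) \<and> (\<forall>w u v. D w u v = b (\<Gamma> w u) v + b u (\<Gamma> w v))"
  assume 2: "bilinear \<Gamma>' \<and> (\<forall>u v. \<Gamma>' u v = \<Gamma>' v u) \<and> (\<forall>w u v. D w u v = b (\<Gamma>' w u) v + b u (\<Gamma>' w v))"
  \<comment> \<open>The alternating sum over permuted arguments isolates one term thanks to
    symmetry, so \<open>\<Gamma>\<close> is determined by \<open>D\<close> up to
    nondegeneracy.\<close>
  have *: "2 * b (\<Gamma> w u) v = D w u v + D u w v - D v w u"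
    if "bilinear \<Gamma> \<and> (\<forall>u v. \<Gamma> u v = \<Gamma> v u) \<and> (\<forall>w u v. D w u v = b (\<Gamma> w u) v + b u (\<Gamma> w v))"
    for \<Gamma> w u v
  proof -
    have D': "D w u v = b (\<Gamma> w u) v + b u (\<Gamma> w v)" for w u v using that by blast
    have s: "\<Gamma> u w = \<Gamma> w u" "\<Gamma> v w = \<Gamma> w v" "\<Gamma> v u = \<Gamma> u v" using that by blast+
    show ?thesis unfolding D' s b(2)[of u] b(2)[of w] by simp
  qed
  show "\<Gamma> = \<Gamma>'"
  proof (intro ext)
    fix w u
    have "b (\<Gamma> w u) v = b (\<Gamma>' w u) v" for v using *[OF 1, of w u v] *[OF 2, of w u v] by linarith
    then have "b (\<Gamma> w u - \<Gamma>' w u) v = 0" for v by (simp add: bilinear_lsub[OF b(1)])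
    then show "\<Gamma> w u = \<Gamma>' w u" using b(3)[of "\<Gamma> w u - \<Gamma>' w u"] by simp
  qed
qed

section \<open>Changes of charts\<close>

text \<open>The common form of \<open>to_coords\<close>, \<open>from_coords\<close> and
  \<open>incl_deriv\<close>, so that a single chain rule serves all three.\<close>

definition tmap :: "('a, 'e::euclidean_space) chart \<Rightarrow> ('a, 'f::euclidean_space) chart \<Rightarrow> 'a \<Rightarrow> 'e \<Rightarrow> 'f" where
  "tmap \<phi> \<psi> q = fd (cmap \<psi> \<circ> cinv \<phi>) (cmap \<phi> q)"

text \<open>The two charts may belong to different manifolds, so that the inclusion of a hypersurface
  is covered as well.\<close>

definition compat :: "('a, 'e::euclidean_space) chart \<Rightarrow> ('a, 'f::euclidean_space) chart \<Rightarrow> bool" where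
  "compat \<phi> \<psi> \<longleftrightarrow> inj_on (cmap \<phi>) (cdom \<phi>) \<and> inj_on (cmap \<psi>) (cdom \<psi>) \<and>
     open (cmap \<phi> ` (cdom \<phi> \<inter> cdom \<psi>)) \<and>
     smooth_on (cmap \<phi> ` (cdom \<phi> \<inter> cdom \<psi>)) (cmap \<psi> \<circ> cinv \<phi>)"

lemma to_coords_tmap: "to_coords M \<phi> p = tmap (chart_at M p) \<phi> p"
  and from_coords_tmap: "from_coords M \<phi> p = tmap \<phi> (chart_at M p) p"
  and incl_deriv_tmap: "incl_deriv M L p = tmap (chart_at L p) (chart_at M p) p"
  by (rule ext, simp add: to_coords_def from_coords_def incl_deriv_def tmap_def)+

lemma cinv_cmap: "inj_on (cmap \<phi>) (cdom \<phi>) \<Longrightarrow> q \<in> cdom \<phi> \<Longrightarrow> cinv \<phi> (cmap \<phi> q) = q"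
  by (simp add: cinv_def)

lemma tmap_has_derivative:
  assumes "compat \<phi> \<psi>" "q \<in> cdom \<phi>" "q \<in> cdom \<psi>"
  shows "((cmap \<psi> \<circ> cinv \<phi>) has_derivative tmap \<phi> \<psi> q) (at (cmap \<phi> q))"
proof -
  have "smooth_on (cmap \<phi> ` (cdom \<phi> \<inter> cdom \<psi>)) (cmap \<psi> \<circ> cinv \<phi>)"
    using assms(1) by (simp add: compat_def)
  moreover have "cmap \<phi> q \<in> cmap \<phi> ` (cdom \<phi> \<inter> cdom \<psi>)" using assms(2,3) by blast
  ultimately show ?thesis unfolding tmap_def by (intro fd_works smooth_on_differentiable)
qed

lemma tmap_linear: "compat \<phi> \<psi> \<Longrightarrow> q \<in> cdom \<phi> \<Longrightarrow> q \<in> cdom \<psi> \<Longrightarrow> linear (tmap \<phi> \<psi> q)"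
  by (rule has_derivative_linear[OF tmap_has_derivative])

lemma tmap_compose_has_derivative:
  assumes "compat \<phi> \<psi>" "q \<in> cdom \<phi>" "q \<in> cdom \<psi>"
    and "(f \<circ> cinv \<psi> has_derivative f') (at (cmap \<psi> q))"
  shows "(f \<circ> cinv \<phi> has_derivative (\<lambda>u. f' (tmap \<phi> \<psi> q u))) (at (cmap \<phi> q))"
proof -
  let ?S = "cmap \<phi> ` (cdom \<phi> \<inter> cdom \<psi>)"
  have inv: "cinv \<phi> (cmap \<phi> q') = q'" if "q' \<in> cdom \<phi>" for q'
    using assms(1) that by (simp add: compat_def cinv_cmap)
  have inv': "cinv \<psi> (cmap \<psi> q') = q'" if "q' \<in> cdom \<psi>" for q'
    using assms(1) that by (simp add: compat_def cinv_cmap)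
  have "((f \<circ> cinv \<psi>) \<circ> (cmap \<psi> \<circ> cinv \<phi>) has_derivative f' \<circ> tmap \<phi> \<psi> q) (at (cmap \<phi> q))"
    using assms(4) inv[OF assms(2)]
    by (intro diff_chain_at tmap_has_derivative assms(1-3)) simp
  \<comment> \<open>The two maps agree only on the chart overlap, whose image is open by
    \<open>compat\<close>.\<close>
  then have "((f \<circ> cinv \<phi>) has_derivative f' \<circ> tmap \<phi> \<psi> q) (at (cmap \<phi> q))"
    by (rule has_derivative_transform_within_open[of _ _ _ _ ?S])
      (use assms(1-3) inv inv' in \<open>auto simp: compat_def\<close>)
  then show ?thesis by (simp add: o_def)
qed

lemma tmap_tmap:
  assumes "compat \<phi> \<psi>" "compat \<psi> \<eta>" "q \<in> cdom \<phi>" "q \<in> cdom \<psi>" "q \<in> cdom \<eta>"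
  shows "tmap \<psi> \<eta> q (tmap \<phi> \<psi> q u) = tmap \<phi> \<eta> q u"
  unfolding tmap_def[of \<phi> \<eta>]
  by (subst fd_eqI[OF tmap_compose_has_derivative[OF assms(1,3,4) tmap_has_derivative[OF assms(2,4,5)]]])
    simp

lemma tmap_self:
  assumes "compat \<phi> \<phi>" "q \<in> cdom \<phi>"
  shows "tmap \<phi> \<phi> q u = u"
proof -
  have "((\<lambda>x. x) has_derivative (\<lambda>u. u)) (at (cmap \<phi> q))" by simp
  then have "((cmap \<phi> \<circ> cinv \<phi>) has_derivative (\<lambda>u. u)) (at (cmap \<phi> q))"
    by (rule has_derivative_transform_within_open[of _ _ _ _ "cmap \<phi> ` cdom \<phi>"])
      (use assms in \<open>auto simp: compat_def cinv_cmap\<close>)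
  then show ?thesis unfolding tmap_def by (simp add: fd_eqI)
qed

section \<open>Charts of a manifold, and vectors and tensors in coordinates\<close>

lemma chart_at:
  assumes "smooth_manifold M" "p \<in> carrier M"
  shows "chart_at M p \<in> atlas M" "p \<in> cdom (chart_at M p)"
proof -
  have "p \<in> (\<Union>\<phi>\<in>atlas M. cdom \<phi>)" using assms unfolding smooth_manifold_def by blast
  then have "\<exists>\<phi>. \<phi> \<in> atlas M \<and> p \<in> cdom \<phi>" by blast
  from someI_ex[OF this] show "chart_at M p \<in> atlas M" "p \<in> cdom (chart_at M p)"
    by (auto simp: chart_at_def)
qed

lemma chart_inj:
  assumes "smooth_manifold M" "\<phi> \<in> atlas M"
  shows "inj_on (cmap \<phi>) (cdom \<phi>)"
proof -
  have "homeomorphic_map (subtopology (topo M) (cdom \<phi>)) (top_of_set (cmap \<phi> ` cdom \<phi>)) (cmap \<phi>)"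
    "openin (topo M) (cdom \<phi>)"
    using assms by (auto simp: smooth_manifold_def)
  then show ?thesis
    using homeomorphic_imp_injective_map openin_subset topspace_subtopology_subset by metis
qed

lemma chart_dom: "smooth_manifold M \<Longrightarrow> \<phi> \<in> atlas M \<Longrightarrow> openin (topo M) (cdom \<phi>)"
  by (simp add: smooth_manifold_def)

lemma chart_dom_subset: "smooth_manifold M \<Longrightarrow> \<phi> \<in> atlas M \<Longrightarrow> q \<in> cdom \<phi> \<Longrightarrow> q \<in> carrier M"
  using chart_dom openin_subset by blast

lemma chart_image_open:
  assumes "smooth_manifold M" "\<phi> \<in> atlas M" "openin (topo M) U"
  shows "open (cmap \<phi> ` (cdom \<phi> \<inter> U))"
proof -
  have h: "homeomorphic_map (subtopology (topo M) (cdom \<phi>)) (top_of_set (cmap \<phi> ` cdom \<phi>)) (cmap \<phi>)"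
    "open (cmap \<phi> ` cdom \<phi>)"
    using assms by (auto simp: smooth_manifold_def)
  have "openin (subtopology (topo M) (cdom \<phi>)) (cdom \<phi> \<inter> U)"
    using assms(3) by (auto simp: openin_subtopology)
  then have "openin (top_of_set (cmap \<phi> ` cdom \<phi>)) (cmap \<phi> ` (cdom \<phi> \<inter> U))"
    using homeomorphic_imp_open_map[OF h(1)] by (simp add: open_map_def)
  then show ?thesis using h(2) openin_open_trans open_openin by blast
qed

lemma compat_atlas:
  assumes "smooth_manifold M" "\<phi> \<in> atlas M" "\<psi> \<in> atlas M"
  shows "compat \<phi> \<psi>"
  using assms chart_image_open[OF assms(1,2) chart_dom[OF assms(1,3)]]
  by (auto simp: compat_def chart_inj smooth_manifold_def)

context
  fixes M :: "('a, 'e::euclidean_space) manifold"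
  assumes M: "smooth_manifold M"
begin

lemma to_from_coords:
  assumes "\<phi> \<in> atlas M" "q \<in> cdom \<phi>"
  shows "to_coords M \<phi> q (from_coords M \<phi> q u) = u" "from_coords M \<phi> q (to_coords M \<phi> q u) = u"
proof -
  have q: "q \<in> carrier M" using chart_dom_subset[OF M assms] .
  note c = compat_atlas[OF M] chart_at[OF M q]
  show "to_coords M \<phi> q (from_coords M \<phi> q u) = u" "from_coords M \<phi> q (to_coords M \<phi> q u) = u"
    unfolding to_coords_tmap from_coords_tmap
    using c assms by (simp_all add: tmap_tmap tmap_self)
qed

lemma linear_from_coords:
  assumes "\<phi> \<in> atlas M" "q \<in> cdom \<phi>"
  shows "linear (from_coords M \<phi> q)"
  unfolding from_coords_tmap
  using assms chart_at[OF M chart_dom_subset[OF M assms]] compat_atlas[OF M] by (simp add: tmap_linear)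

lemma coords_chart_at:
  assumes "q \<in> carrier M"
  shows "to_coords M (chart_at M q) q u = u" "from_coords M (chart_at M q) q u = u"
  unfolding to_coords_tmap from_coords_tmap
  using chart_at[OF M assms] compat_atlas[OF M] by (simp_all add: tmap_self)

lemma cinv_atlas: "\<phi> \<in> atlas M \<Longrightarrow> q \<in> cdom \<phi> \<Longrightarrow> cinv \<phi> (cmap \<phi> q) = q"
  by (simp add: cinv_cmap chart_inj[OF M])

lemma field_coords_chart_at:
  assumes "p \<in> carrier M"
  shows "field_coords M (chart_at M p) X (cmap (chart_at M p) p) = X p"
  using assms by (simp add: field_coords_def cinv_atlas chart_at[OF M] coords_chart_at)

lemma tensor_coords_eval:
  assumes "\<phi> \<in> atlas M" "q \<in> cdom \<phi>"
  shows "tensor_coords M \<phi> g (cmap \<phi> q) u v = g q (from_coords M \<phi> q u) (from_coords M \<phi> q v)"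
    "g q u v = tensor_coords M \<phi> g (cmap \<phi> q) (to_coords M \<phi> q u) (to_coords M \<phi> q v)"
  using assms by (simp_all add: tensor_coords_def cinv_atlas to_from_coords)

lemma tensor_coords_chart_at:
  assumes "p \<in> carrier M"
  shows "tensor_coords M (chart_at M p) g (cmap (chart_at M p) p) = g p"
  using assms by (intro ext) (simp add: tensor_coords_eval(1) chart_at[OF M] coords_chart_at)

lemma bilinear_tensor_coords:
  assumes "\<phi> \<in> atlas M" "q \<in> cdom \<phi>" "bilinear (g q)"
  shows "bilinear (tensor_coords M \<phi> g (cmap \<phi> q))"
proof -
  note lin = linear_from_coords[OF assms(1,2)]
  show ?thesis unfolding bilinear_def
    by (intro conjI allI linearI) (simp_all add: tensor_coords_eval(1)[OF assms(1,2)]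
        linear_add[OF lin] linear_cmul[OF lin] bilinear_ladd[OF assms(3)] bilinear_radd[OF assms(3)]
        bilinear_lmul[OF assms(3)] bilinear_rmul[OF assms(3)])
qed

lemma vector_field_onD:
  assumes "vector_field_on M U X" "\<phi> \<in> atlas M"
  shows "smooth_on (cmap \<phi> ` (cdom \<phi> \<inter> U)) (field_coords M \<phi> X)"
  using assms by (simp add: vector_field_on_def)

lemma vector_fieldD:
  assumes "vector_field M X" "\<phi> \<in> atlas M"
  shows "smooth_on (cmap \<phi> ` cdom \<phi>) (field_coords M \<phi> X)"
proof -
  have "cdom \<phi> \<inter> carrier M = cdom \<phi>" using chart_dom_subset[OF M assms(2)] by blast
  then show ?thesis using vector_field_onD[OF assms] by simp
qed

lemma symmetric_tensor_fieldD:
  assumes "symmetric_tensor_field M g"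
  shows "p \<in> carrier M \<Longrightarrow> bilinear (g p)" "p \<in> carrier M \<Longrightarrow> g p u v = g p v u"
    "\<phi> \<in> atlas M \<Longrightarrow> smooth_on (cmap \<phi> ` cdom \<phi>) (\<lambda>x. tensor_coords M \<phi> g x u v)"
  using assms by (auto simp: symmetric_tensor_field_def)

lemma chart_image_open': "\<phi> \<in> atlas M \<Longrightarrow> open (cmap \<phi> ` cdom \<phi>)"
  using M by (simp add: smooth_manifold_def)

text \<open>Koszul's formula supplies the unique existence behind the definite description, after
  which its defining properties can be read off.\<close>

lemma christoffel:
  assumes g: "symmetric_tensor_field M g" and p: "p \<in> carrier M"
    and nondeg: "\<And>u. (\<And>v. g p u v = 0) \<Longrightarrow> u = 0"
  shows "bilinear (christoffel M g p)" "christoffel M g p u v = christoffel M g p v u"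
    "fd (\<lambda>x. tensor_coords M (chart_at M p) g x u v) (cmap (chart_at M p) p) w
       = g p (christoffel M g p w u) v + g p u (christoffel M g p w v)"
proof -
  let ?\<phi> = "chart_at M p"
  let ?S = "cmap ?\<phi> ` cdom ?\<phi>"
  let ?x = "cmap ?\<phi> p"
  define D where "D = (\<lambda>w u v. fd (\<lambda>x. tensor_coords M ?\<phi> g x u v) ?x w)"
  note c = chart_at[OF M p]
  have S: "open ?S" "?x \<in> ?S" using chart_image_open' c by auto
  have diff: "(\<lambda>x. tensor_coords M ?\<phi> g x u v) differentiable at ?x" for u v
    using smooth_on_differentiable[OF symmetric_tensor_fieldD(3)[OF g c(1)] S(2)] .
  have bil: "bilinear (tensor_coords M ?\<phi> g x)" if "x \<in> ?S" for x
    using that by (auto intro!: bilinear_tensor_coords c(1) symmetric_tensor_fieldD(1)[OF g]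
        chart_dom_subset[OF M c(1)])
  have D1: "linear (\<lambda>w. D w u v)" for u v
    using linear_fd[OF diff] by (simp add: D_def)
  have sym: "D w u v = D w v u" for w u v
  proof -
    have "fd (\<lambda>x. tensor_coords M ?\<phi> g x u v) ?x = fd (\<lambda>x. tensor_coords M ?\<phi> g x v u) ?x"
      by (rule fd_cong[OF S])
        (auto simp: tensor_coords_eval(1)[OF c(1)]
          intro!: symmetric_tensor_fieldD(2)[OF g] chart_dom_subset[OF M c(1)])
    then show ?thesis by (simp add: D_def)
  qed
  \<comment> \<open>Bilinearity holds at all points of the chart, so it survives differentiation in
    the base point.\<close>
  have D2: "linear (\<lambda>u. D w u v)" for w v
  proof (rule linearI)
    fix a b :: 'e and r :: real
    have "fd (\<lambda>x. tensor_coords M ?\<phi> g x (a + b) v) ?x =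
        fd (\<lambda>x. tensor_coords M ?\<phi> g x a v + tensor_coords M ?\<phi> g x b v) ?x"
      by (rule fd_cong[OF S]) (simp add: bilinear_ladd[OF bil])
    also have "\<dots> = (\<lambda>w. D w a v + D w b v)"
      unfolding D_def by (intro fd_eqI has_derivative_add fd_works diff)
    finally show "D w (a + b) v = D w a v + D w b v" by (simp add: D_def)
    have "fd (\<lambda>x. tensor_coords M ?\<phi> g x (r *\<^sub>R a) v) ?x = fd (\<lambda>x. r *\<^sub>R tensor_coords M ?\<phi> g x a v) ?x"
      by (rule fd_cong[OF S]) (simp add: bilinear_lmul[OF bil])
    also have "\<dots> = (\<lambda>w. r *\<^sub>R D w a v)"
      unfolding D_def by (intro fd_eqI has_derivative_scaleR_right fd_works diff)
    finally show "D w (r *\<^sub>R a) v = r *\<^sub>R D w a v" by (simp add: D_def)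
  qed
  have ex: "\<exists>!\<Gamma>. bilinear \<Gamma> \<and> (\<forall>u v. \<Gamma> u v = \<Gamma> v u) \<and> (\<forall>w u v. D w u v = g p (\<Gamma> w u) v + g p u (\<Gamma> w v))"
    by (rule koszul[OF symmetric_tensor_fieldD(1,2)[OF g p] nondeg D1 D2 sym])
  have eq: "christoffel M g p = (THE \<Gamma>. bilinear \<Gamma> \<and> (\<forall>u v. \<Gamma> u v = \<Gamma> v u) \<and>
      (\<forall>w u v. D w u v = g p (\<Gamma> w u) v + g p u (\<Gamma> w v)))"
    unfolding christoffel_def D_def Let_def by (rule refl)
  note * = theI'[OF ex, folded eq]
  from conjunct1[OF *] show "bilinear (christoffel M g p)" .
  from conjunct1[OF conjunct2[OF *]] show "christoffel M g p u v = christoffel M g p v u"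
    by (elim allE)
  from conjunct2[OF conjunct2[OF *]]
  have "D w u v = g p (christoffel M g p w u) v + g p u (christoffel M g p w v)"
    by (elim allE)
  then show "fd (\<lambda>x. tensor_coords M ?\<phi> g x u v) ?x w
       = g p (christoffel M g p w u) v + g p u (christoffel M g p w v)"
    by (simp add: D_def)
qed

end

section \<open>Null hypersurfaces with a rigging\<close>

text \<open>The range has codimension one, so a single transverse vector completes it to the whole
  space.\<close>

lemma hyperplane_decompose:
  fixes f :: "'f::euclidean_space \<Rightarrow> 'e::euclidean_space"
  assumes "linear f" "inj f" "DIM('e) = DIM('f) + 1" "z \<notin> range f"
  shows "\<exists>a v. w = f v + a *\<^sub>R z"
proof -
  have sub: "subspace (range f)" using assms(1) by (simp add: linear_subspace_image)
  then have sp: "span (range f) = range f" by (simp add: span_eq_iff)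
  have "dim (range f) = DIM('f)" using dim_image_eq[OF assms(1), of UNIV] assms(2) by (simp add: dim_UNIV)
  then have "dim (insert z (range f)) = DIM('e)" using assms(3,4) unfolding dim_insert sp by simp
  then have "span (insert z (range f)) = UNIV" using dim_eq_full by blast
  then obtain a where "w - a *\<^sub>R z \<in> range f" using span_breakdown_eq[of w z "range f"] sp by auto
  then obtain v where "w - a *\<^sub>R z = f v" by blast
  then have "w = f v + a *\<^sub>R z" by (simp add: algebra_simps)
  then show ?thesis by blast
qed

section \<open>Derivatives of functions along tangent vectors\<close>

lemma dir_deriv_eqI:
  assumes "(f \<circ> cinv (chart_at M p) has_derivative f') (at (cmap (chart_at M p) p))"
  shows "dir_deriv M f p v = f' v"
  using fd_eqI[OF assms] by (simp add: dir_deriv_def)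

lemma dir_deriv_cong:
  assumes M: "smooth_manifold M" and p: "p \<in> carrier M" and eq: "\<And>q. q \<in> carrier M \<Longrightarrow> f q = f' q"
  shows "dir_deriv M f p v = dir_deriv M f' p v"
proof -
  note c = chart_at[OF M p]
  have "fd (f \<circ> cinv (chart_at M p)) (cmap (chart_at M p) p) =
      fd (f' \<circ> cinv (chart_at M p)) (cmap (chart_at M p) p)"
    by (rule fd_cong[OF chart_image_open'[OF M c(1)]])
      (use c in \<open>auto simp: cinv_atlas[OF M c(1)] intro!: eq chart_dom_subset[OF M c(1)]\<close>)
  then show ?thesis by (simp add: dir_deriv_def)
qed

lemma dir_deriv_const:
  assumes "smooth_manifold M" "p \<in> carrier M" "\<And>q. q \<in> carrier M \<Longrightarrow> f q = c"
  shows "dir_deriv M f p v = 0"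
proof -
  have "dir_deriv M f p v = dir_deriv M (\<lambda>q. c) p v" by (rule dir_deriv_cong[OF assms])
  also have "\<dots> = 0" by (rule dir_deriv_eqI) (simp add: o_def)
  finally show ?thesis .
qed

locale rigged_null_hypersurface =
  fixes M :: "('a, 'e::euclidean_space) manifold"
    and g :: "('a, 'e) tensor2"
    and L :: "('a, 'f::euclidean_space) manifold"
    and W :: "'a set"
    and \<zeta> :: "'a \<Rightarrow> 'e"
    and \<xi> :: "'a \<Rightarrow> 'f"
  assumes lorentzian: "lorentzian_manifold M g"
    and null: "null_hypersurface M g L"
    and rigging: "rigging M L W \<zeta>"
    and rigged: "rigged_vector_field M g L \<zeta> \<xi>"
begin

abbreviation "\<iota> \<equiv> incl_deriv M L"
abbreviation "\<alpha> \<equiv> rigging_form g \<zeta>"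
abbreviation "\<omega> \<equiv> rigged_form M g L \<zeta>"
abbreviation "g\<^sub>r \<equiv> rigged_metric M g L \<zeta>"

definition pullback :: "('a, 'f) tensor2" where
  "pullback q u v = g q (\<iota> q u) (\<iota> q v)"

lemma M: "smooth_manifold M" and sym_g: "symmetric_tensor_field M g"
  using lorentzian by (auto simp: lorentzian_manifold_def)

lemma hyp: "hypersurface M L"
  using null by (simp add: null_hypersurface_def)

lemma L: "smooth_manifold L"
  using hyp by (simp add: hypersurface_def)

lemma continuous_inclusion: "continuous_map (topo L) (topo M) (\<lambda>p. p)"
  using hyp by (simp add: hypersurface_def)

lemma carrier_L: "q \<in> carrier L \<Longrightarrow> q \<in> carrier M"
  using continuous_inclusion unfolding continuous_map_def by auto

lemma carrier_W: "q \<in> carrier L \<Longrightarrow> q \<in> W"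
  using rigging unfolding rigging_def by blast

lemma xi_field: "vector_field L \<xi>"
  using rigged by (simp add: rigged_vector_field_def)

lemma bilinear_g: "q \<in> carrier M \<Longrightarrow> bilinear (g q)"
  and symmetric_g: "q \<in> carrier M \<Longrightarrow> g q u v = g q v u"
  using symmetric_tensor_fieldD[OF M sym_g] by blast+

lemma nondegenerate_g: "q \<in> carrier M \<Longrightarrow> (\<And>v. g q u v = 0) \<Longrightarrow> u = 0"
  using lorentzian_nondegenerate[OF bilinear_g symmetric_g] lorentzian
  by (simp add: lorentzian_manifold_def)

text \<open>The topology of \<open>L\<close> may be finer than the subspace topology; continuity of
  the inclusion is what makes the overlap with a chart of \<open>M\<close> open in
  \<open>L\<close>.\<close>

lemma compat_LM:
  assumes "\<phi> \<in> atlas L" "\<psi> \<in> atlas M"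
  shows "compat \<phi> \<psi>"
proof -
  let ?U = "{q \<in> carrier L. q \<in> cdom \<psi>}"
  have "openin (topo L) ?U"
    using continuous_inclusion chart_dom[OF M assms(2)] by (simp add: openin_continuous_map_preimage)
  moreover have "cdom \<phi> \<inter> cdom \<psi> = cdom \<phi> \<inter> ?U" using chart_dom_subset[OF L assms(1)] by blast
  ultimately have "open (cmap \<phi> ` (cdom \<phi> \<inter> cdom \<psi>))" using chart_image_open[OF L assms(1)] by metis
  then show ?thesis
    using assms hyp chart_inj[OF L assms(1)] chart_inj[OF M assms(2)]
    by (simp add: compat_def hypersurface_def)
qed

lemma linear_incl: "q \<in> carrier L \<Longrightarrow> linear (\<iota> q)"
  unfolding incl_deriv_tmap
  by (intro tmap_linear compat_LM chart_at[OF L] chart_at[OF M] carrier_L)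

lemma inj_incl: "q \<in> carrier L \<Longrightarrow> inj (\<iota> q)"
  using hyp by (simp add: hypersurface_def)

section \<open>Linear algebra of the pulled back forms and their radical\<close>

lemma linear_omega: "q \<in> carrier L \<Longrightarrow> linear (\<omega> q)"
  unfolding rigged_form_def rigging_form_def
  using linear_compose[OF linear_incl bilinear_linear_right[OF bilinear_g[OF carrier_L]]]
  by (simp add: o_def)

lemma bilinear_pullback: "q \<in> carrier L \<Longrightarrow> bilinear (pullback q)"
  using linear_compose[OF linear_incl bilinear_linear_right[OF bilinear_g[OF carrier_L]]]
    linear_compose[OF linear_incl bilinear_linear_left[OF bilinear_g[OF carrier_L]]]
  by (simp add: o_def bilinear_def pullback_def)

lemma pullback_sym: "q \<in> carrier L \<Longrightarrow> pullback q u v = pullback q v u"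
  unfolding pullback_def by (rule symmetric_g[OF carrier_L])

lemma rigged_metric_eq: "g\<^sub>r q u v = pullback q u v + \<omega> q u * \<omega> q v"
  by (simp add: rigged_metric_def pullback_def rigged_form_def Let_def)

lemma bilinear_rigged_metric:
  assumes "q \<in> carrier L"
  shows "bilinear (g\<^sub>r q)"
proof -
  note 1 = linear_omega[OF assms] and 2 = bilinear_pullback[OF assms]
  show ?thesis unfolding bilinear_def rigged_metric_eq
    by (intro conjI allI linearI)
      (simp_all add: linear_add[OF 1] linear_cmul[OF 1] bilinear_ladd[OF 2] bilinear_radd[OF 2]
        bilinear_lmul[OF 2] bilinear_rmul[OF 2] algebra_simps)
qed

text \<open>Transversality of \<open>\<zeta>\<close> forces \<open>\<omega>\<close> to be nonzero on
  a nonzero radical vector: otherwise its image would be orthogonal to the tangent space of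
  \<open>L\<close> and to \<open>\<zeta>\<close>, which together span everything. Rescaling then
  gives \<open>\<omega> q n = 1\<close>.\<close>

lemma null_direction:
  assumes q: "q \<in> carrier L"
  obtains n where "\<omega> q n = 1" "\<And>v. pullback q n v = 0"
proof -
  obtain n where n: "n \<noteq> 0" "\<And>v. g q (\<iota> q n) (\<iota> q v) = 0"
    using null q unfolding null_hypersurface_def by blast
  have "\<omega> q n \<noteq> 0"
  proof
    assume 0: "\<omega> q n = 0"
    have "g q (\<iota> q n) w = 0" for w
    proof -
      have "\<zeta> q \<notin> range (\<iota> q)" using rigging q by (simp add: rigging_def)
      then obtain a v where "w = \<iota> q v + a *\<^sub>R \<zeta> q"
        using hyperplane_decompose[OF linear_incl[OF q] inj_incl[OF q]] hyp
        unfolding hypersurface_def by blast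
      moreover have "g q (\<iota> q n) (\<zeta> q) = 0"
        using 0 symmetric_g[OF carrier_L[OF q]] by (simp add: rigged_form_def rigging_form_def)
      ultimately show ?thesis
        using n(2) bilinear_radd[OF bilinear_g[OF carrier_L[OF q]]]
          bilinear_rmul[OF bilinear_g[OF carrier_L[OF q]]] by simp
    qed
    then have "\<iota> q n = 0" using nondegenerate_g[OF carrier_L[OF q]] by blast
    then show False using n(1) linear_injective_0[OF linear_incl[OF q]] inj_incl[OF q] by blast
  qed
  then show ?thesis
    using n(2) linear_cmul[OF linear_omega[OF q]] bilinear_lmul[OF bilinear_pullback[OF q]]
    by (intro that[of "(1 / \<omega> q n) *\<^sub>R n"]) (simp_all add: pullback_def)
qed

text \<open>The tangent space of \<open>L\<close> lies in the orthogonal complement of the null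
  vector \<open>\<iota> q n\<close>, where a Lorentzian form is semidefinite with that null line as
  its kernel.\<close>

lemma pullback_definite:
  assumes q: "q \<in> carrier L" and n: "\<omega> q n = 1" "\<And>v. pullback q n v = 0"
  shows "pullback q w w \<ge> 0" "pullback q w w = 0 \<Longrightarrow> w \<in> span {n}"
proof -
  have "n \<noteq> 0" using n(1) linear_0[OF linear_omega[OF q]] by auto
  then have "\<iota> q n \<noteq> 0" using linear_injective_0[OF linear_incl[OF q]] inj_incl[OF q] by blast
  moreover have "lorentzian_form (g q)"
    using lorentzian carrier_L[OF q] by (simp add: lorentzian_manifold_def)
  moreover have "g q (\<iota> q n) (\<iota> q v) = 0" for v using n(2) by (simp add: pullback_def)
  ultimately have *: "g q (\<iota> q w) (\<iota> q w) \<ge> 0"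
    "g q (\<iota> q w) (\<iota> q w) = 0 \<Longrightarrow> \<exists>c. \<iota> q w = c *\<^sub>R \<iota> q n"
    using lorentzian_null_perp[OF bilinear_g[OF carrier_L[OF q]] symmetric_g[OF carrier_L[OF q]],
        of "\<iota> q n" "\<iota> q w"] by blast+
  show "pullback q w w \<ge> 0" using *(1) by (simp add: pullback_def)
  assume "pullback q w w = 0"
  then obtain c where "\<iota> q w = \<iota> q (c *\<^sub>R n)"
    using *(2) by (auto simp: pullback_def linear_cmul[OF linear_incl[OF q]])
  then have "w = c *\<^sub>R n" using inj_incl[OF q] by (simp add: inj_eq)
  then show "w \<in> span {n}" by (simp add: span_base span_scale)
qed

text \<open>The square of \<open>\<omega>\<close> is positive exactly where help is needed: on the
  null line, where the semidefinite pullback vanishes.\<close>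

lemma rigged_metric_pos:
  assumes q: "q \<in> carrier L" and "w \<noteq> 0"
  shows "g\<^sub>r q w w > 0"
proof -
  obtain n where n: "\<omega> q n = 1" "\<And>v. pullback q n v = 0" using null_direction[OF q] by blast
  show ?thesis
  proof (cases "pullback q w w = 0")
    case True
    then obtain c where c: "w = c *\<^sub>R n"
      using pullback_definite(2)[OF q n] by (auto simp: span_singleton)
    then have "\<omega> q w = c" using n(1) linear_cmul[OF linear_omega[OF q]] by simp
    moreover have "c \<noteq> 0" using c assms(2) by auto
    then have "c * c > 0" using not_real_square_gt_zero[of c] by blast
    ultimately show ?thesis using True by (simp add: rigged_metric_eq)
  next
    case False
    then have "pullback q w w > 0" using pullback_definite(1)[OF q n, of w] by simp
    then show ?thesis by (simp add: rigged_metric_eq add_pos_nonneg)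
  qed
qed

text \<open>The normalised radical vector \<open>n\<close> solves the equation that defines
  \<open>\<xi>\<close>, and a positive definite form admits only one solution.\<close>

lemma xi_null:
  assumes q: "q \<in> carrier L"
  shows "\<omega> q (\<xi> q) = 1" "pullback q (\<xi> q) v = 0"
proof -
  obtain n where n: "\<omega> q n = 1" "\<And>v. pullback q n v = 0" using null_direction[OF q] by blast
  have "g\<^sub>r q (\<xi> q) v = g\<^sub>r q n v" for v
    using rigged q n by (simp add: rigged_vector_field_def rigged_metric_eq)
  then have "g\<^sub>r q (\<xi> q - n) (\<xi> q - n) = 0" by (simp add: bilinear_lsub[OF bilinear_rigged_metric[OF q]])
  then have "\<xi> q = n" using rigged_metric_pos[OF q, of "\<xi> q - n"] by (cases "\<xi> q - n = 0") auto
  then show "\<omega> q (\<xi> q) = 1" "pullback q (\<xi> q) v = 0" using n by auto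
qed

lemma xi_nonzero: "q \<in> carrier L \<Longrightarrow> \<xi> q \<noteq> 0"
  using xi_null(1)[of q] linear_0[OF linear_omega[of q]] by auto

section \<open>Coordinate expressions and smoothness of the pulled back tensors\<close>

lemma incl_coords:
  assumes "\<phi> \<in> atlas L" "\<psi> \<in> atlas M" "q \<in> cdom \<phi>" "q \<in> cdom \<psi>"
  shows "\<iota> q (from_coords L \<phi> q u) = from_coords M \<psi> q (tmap \<phi> \<psi> q u)"
    "to_coords M \<psi> q (\<iota> q u) = tmap \<phi> \<psi> q (to_coords L \<phi> q u)"
proof -
  have q: "q \<in> carrier L" "q \<in> carrier M" using chart_dom_subset[OF L assms(1,3)] carrier_L by auto
  \<comment> \<open>Both sides pass through the preferred charts at \<open>q\<close> and collapse by
    \<open>tmap_tmap\<close> to one transition differential.\<close>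
  note c = chart_at[OF L q(1)] chart_at[OF M q(2)]
  show "\<iota> q (from_coords L \<phi> q u) = from_coords M \<psi> q (tmap \<phi> \<psi> q u)"
    "to_coords M \<psi> q (\<iota> q u) = tmap \<phi> \<psi> q (to_coords L \<phi> q u)"
    unfolding incl_deriv_tmap from_coords_tmap to_coords_tmap
    using assms c compat_LM compat_atlas[OF L] compat_atlas[OF M]
    by (simp_all add: tmap_tmap)
qed

lemma pullback_coords:
  assumes "\<phi> \<in> atlas L" "\<psi> \<in> atlas M" "q \<in> cdom \<phi>" "q \<in> cdom \<psi>"
  shows "tensor_coords L \<phi> pullback (cmap \<phi> q) u v =
    tensor_coords M \<psi> g (cmap \<psi> q) (tmap \<phi> \<psi> q u) (tmap \<phi> \<psi> q v)"
  by (simp add: tensor_coords_eval(1)[OF L assms(1,3)] tensor_coords_eval(1)[OF M assms(2,4)]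
      pullback_def incl_coords[OF assms])

lemma rigging_form_coords:
  assumes "\<psi> \<in> atlas M" "q \<in> cdom \<psi>"
  shows "form_coords M \<psi> \<alpha> (cmap \<psi> q) v =
    tensor_coords M \<psi> g (cmap \<psi> q) (field_coords M \<psi> \<zeta> (cmap \<psi> q)) v"
  by (simp add: tensor_coords_eval(1)[OF M assms] form_coords_def rigging_form_def field_coords_def
      cinv_atlas[OF M assms] to_from_coords[OF M assms])

lemma rigged_form_coords:
  assumes "\<phi> \<in> atlas L" "\<psi> \<in> atlas M" "q \<in> cdom \<phi>" "q \<in> cdom \<psi>"
  shows "form_coords L \<phi> \<omega> (cmap \<phi> q) v = form_coords M \<psi> \<alpha> (cmap \<psi> q) (tmap \<phi> \<psi> q v)"
  by (simp add: form_coords_def rigged_form_def cinv_atlas[OF M assms(2,4)] cinv_atlas[OF L assms(1,3)]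
      incl_coords[OF assms])

lemma bilinear_g_coords: "\<psi> \<in> atlas M \<Longrightarrow> q \<in> cdom \<psi> \<Longrightarrow> bilinear (tensor_coords M \<psi> g (cmap \<psi> q))"
  by (intro bilinear_tensor_coords[OF M] bilinear_g chart_dom_subset[OF M])

lemma linear_rigging_form_coords:
  assumes "\<psi> \<in> atlas M" "q \<in> cdom \<psi>"
  shows "linear (form_coords M \<psi> \<alpha> (cmap \<psi> q))"
proof -
  have "form_coords M \<psi> \<alpha> (cmap \<psi> q) =
      tensor_coords M \<psi> g (cmap \<psi> q) (field_coords M \<psi> \<zeta> (cmap \<psi> q))"
    by (rule ext) (rule rigging_form_coords[OF assms])
  then show ?thesis using bilinear_linear_right[OF bilinear_g_coords[OF assms]] by simp
qed

lemma smooth_rigging_form_coords: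
  assumes "\<psi> \<in> atlas M"
  shows "smooth_on (cmap \<psi> ` (cdom \<psi> \<inter> W)) (\<lambda>y. form_coords M \<psi> \<alpha> y v)"
proof -
  have W: "openin (topo M) W" "vector_field_on M W \<zeta>" using rigging by (auto simp: rigging_def)
  have op: "open (cmap \<psi> ` (cdom \<psi> \<inter> W))" by (rule chart_image_open[OF M assms W(1)])
  have "smooth_on (cmap \<psi> ` (cdom \<psi> \<inter> W)) (\<lambda>y. tensor_coords M \<psi> g y (field_coords M \<psi> \<zeta> y) v)"
  proof (rule smooth_on_bilinear_apply[OF op, where G = "tensor_coords M \<psi> g"])
    show "smooth_on (cmap \<psi> ` (cdom \<psi> \<inter> W)) (\<lambda>x. tensor_coords M \<psi> g x i j)" for i j
      by (rule smooth_on_subset[OF symmetric_tensor_fieldD(3)[OF M sym_g assms]]) blast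
  qed (use bilinear_g_coords[OF assms] vector_field_onD[OF M W(2) assms] in
      \<open>auto intro: smooth_on_const[OF op]\<close>)
  then show ?thesis
    by (rule smooth_on_cong[OF op, rotated]) (auto simp: rigging_form_coords[OF assms])
qed

text \<open>The image lands in \<open>W\<close> because overlap points belong to \<open>L\<close>;
  this is where the rigging is known to be smooth.\<close>

lemma transition:
  assumes "\<phi> \<in> atlas L" "\<psi> \<in> atlas M"
  defines "S \<equiv> cmap \<phi> ` (cdom \<phi> \<inter> cdom \<psi>)"
  shows "open S" "smooth_on S (cmap \<psi> \<circ> cinv \<phi>)" "(cmap \<psi> \<circ> cinv \<phi>) ` S \<subseteq> cmap \<psi> ` (cdom \<psi> \<inter> W)"
    "\<And>q. q \<in> cdom \<phi> \<Longrightarrow> (cmap \<psi> \<circ> cinv \<phi>) (cmap \<phi> q) = cmap \<psi> q"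
  using compat_LM[OF assms(1,2)] carrier_W chart_dom_subset[OF L assms(1)]
  by (auto simp: compat_def S_def cinv_cmap)

text \<open>A chart domain of \<open>L\<close> need not fit into one chart of \<open>M\<close>, so
  smoothness is checked near each point, with a chart of \<open>M\<close> chosen there.\<close>

lemma smooth_pullback_coords:
  assumes "\<phi> \<in> atlas L"
  shows "smooth_on (cmap \<phi> ` cdom \<phi>) (\<lambda>x. tensor_coords L \<phi> pullback x u v)"
    "smooth_on (cmap \<phi> ` cdom \<phi>) (\<lambda>x. form_coords L \<phi> \<omega> x u)"
proof -
  have "\<exists>T. open T \<and> x \<in> T \<and> smooth_on T (\<lambda>x. tensor_coords L \<phi> pullback x u v) \<and>
      smooth_on T (\<lambda>x. form_coords L \<phi> \<omega> x u)" if "x \<in> cmap \<phi> ` cdom \<phi>" for x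
  proof -
    obtain q where q: "q \<in> cdom \<phi>" "x = cmap \<phi> q" using \<open>x \<in> _\<close> by blast
    define \<psi> where "\<psi> = chart_at M q"
    have \<psi>: "\<psi> \<in> atlas M" "q \<in> cdom \<psi>"
      using chart_at[OF M carrier_L[OF chart_dom_subset[OF L assms q(1)]]] by (auto simp: \<psi>_def)
    define S where "S = cmap \<phi> ` (cdom \<phi> \<inter> cdom \<psi>)"
    define F where "F = cmap \<psi> \<circ> cinv \<phi>"
    note tr = transition[OF assms \<psi>(1), folded S_def F_def]
    have F: "F (cmap \<phi> q) = cmap \<psi> q" "fd F (cmap \<phi> q) = tmap \<phi> \<psi> q" if "q \<in> cdom \<phi>" for q
      using tr(4)[OF that] by (auto simp: F_def tmap_def)
    have dF: "smooth_on S (\<lambda>x. fd F x u)" for u by (rule smooth_on_fd[OF tr(1,2) smooth_on_const[OF tr(1)]])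
    have sub: "cmap \<psi> ` (cdom \<psi> \<inter> W) \<subseteq> cmap \<psi> ` cdom \<psi>" by blast
    have op: "open (cmap \<psi> ` (cdom \<psi> \<inter> W))"
      by (rule chart_image_open[OF M \<psi>(1)]) (use rigging in \<open>simp add: rigging_def\<close>)
    have "smooth_on S (\<lambda>x. tensor_coords M \<psi> g (F x) (fd F x u) (fd F x v))"
    proof (rule smooth_on_bilinear_apply[OF tr(1), where G = "\<lambda>x. tensor_coords M \<psi> g (F x)"])
      show "smooth_on S (\<lambda>x. tensor_coords M \<psi> g (F x) i j)" for i j
        by (rule smooth_on_compose[OF tr(1) op tr(3,2)])
          (rule smooth_on_subset[OF symmetric_tensor_fieldD(3)[OF M sym_g \<psi>(1)] sub])
    qed (use bilinear_g_coords[OF \<psi>(1)] dF F in \<open>auto simp: S_def\<close>)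
    then have 1: "smooth_on S (\<lambda>x. tensor_coords L \<phi> pullback x u v)"
      by (rule smooth_on_cong[OF tr(1), rotated]) (auto simp: S_def F pullback_coords[OF assms \<psi>(1)])
    have "smooth_on S (\<lambda>x. form_coords M \<psi> \<alpha> (F x) (fd F x u))"
    proof (rule smooth_on_linear_apply[OF tr(1), where B = "\<lambda>x. form_coords M \<psi> \<alpha> (F x)"])
      show "smooth_on S (\<lambda>x. form_coords M \<psi> \<alpha> (F x) i)" for i
        by (rule smooth_on_compose[OF tr(1) op tr(3,2) smooth_rigging_form_coords[OF \<psi>(1)]])
    qed (use linear_rigging_form_coords[OF \<psi>(1)] dF F in \<open>auto simp: S_def\<close>)
    then have 2: "smooth_on S (\<lambda>x. form_coords L \<phi> \<omega> x u)"
      by (rule smooth_on_cong[OF tr(1), rotated]) (auto simp: S_def F rigged_form_coords[OF assms \<psi>(1)])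
    show ?thesis using 1 2 tr(1) q \<psi>(2) by (intro exI[of _ S]) (auto simp: S_def)
  qed
  then show "smooth_on (cmap \<phi> ` cdom \<phi>) (\<lambda>x. tensor_coords L \<phi> pullback x u v)"
    "smooth_on (cmap \<phi> ` cdom \<phi>) (\<lambda>x. form_coords L \<phi> \<omega> x u)"
    by (metis smooth_on_locally)+
qed

lemma riemannian_rigged_metric: "riemannian_metric L g\<^sub>r"
  unfolding riemannian_metric_def symmetric_tensor_field_def
proof (intro conjI ballI allI impI)
  fix q u v
  assume "q \<in> carrier L"
  then show "g\<^sub>r q u v = g\<^sub>r q v u" by (simp add: rigged_metric_eq pullback_sym)
next
  fix \<phi> u v assume \<phi>: "\<phi> \<in> atlas L"
  have "smooth_on (cmap \<phi> ` cdom \<phi>)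
      (\<lambda>x. tensor_coords L \<phi> pullback x u v + form_coords L \<phi> \<omega> x u * form_coords L \<phi> \<omega> x v)"
    using \<phi> by (intro smooth_on_add smooth_on_mult chart_image_open'[OF L] smooth_pullback_coords)
  then show "smooth_on (cmap \<phi> ` cdom \<phi>) (\<lambda>x. tensor_coords L \<phi> g\<^sub>r x u v)"
    by (simp add: tensor_coords_def form_coords_def rigged_metric_eq Let_def)
qed (simp_all add: bilinear_rigged_metric rigged_metric_pos)

end

context rigged_null_hypersurface
begin

section \<open>The connection along the hypersurface\<close>

text \<open>Components, in the preferred chart of \<open>M\<close> at \<open>p\<close>, of the field \<open>V\<close> on \<open>L\<close>, as a function of the
  coordinates of the preferred chart of \<open>L\<close> at \<open>p\<close>.\<close>

definition push :: "'a \<Rightarrow> ('a \<Rightarrow> 'f) \<Rightarrow> 'f \<Rightarrow> 'e" where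
  "push p V x = fd (cmap (chart_at M p) \<circ> cinv (chart_at L p)) x (field_coords L (chart_at L p) V x)"

context
  fixes p
  assumes p: "p \<in> carrier L"
begin

abbreviation (input) "\<phi> \<equiv> chart_at L p"
abbreviation (input) "\<psi> \<equiv> chart_at M p"
abbreviation (input) "S \<equiv> cmap \<phi> ` (cdom \<phi> \<inter> cdom \<psi>)"
abbreviation (input) "F \<equiv> cmap \<psi> \<circ> cinv \<phi>"
abbreviation (input) "x\<^sub>0 \<equiv> cmap \<phi> p"

lemma chL: "\<phi> \<in> atlas L" "p \<in> cdom \<phi>" and chM: "\<psi> \<in> atlas M" "p \<in> cdom \<psi>"
  using chart_at[OF L p] chart_at[OF M carrier_L[OF p]] by auto

lemma x0_in_S: "x\<^sub>0 \<in> S"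
  using chL chM by blast

lemma F_eval: "q \<in> cdom \<phi> \<Longrightarrow> F (cmap \<phi> q) = cmap \<psi> q"
  by (rule transition(4)[OF chL(1) chM(1)])

lemma fd_F: "fd F (cmap \<phi> q) = tmap \<phi> \<psi> q" "fd F x\<^sub>0 = \<iota> p"
  by (simp_all add: tmap_def incl_deriv_tmap)

lemma F_differentiable: "x \<in> S \<Longrightarrow> F differentiable at x"
  by (rule smooth_on_differentiable[OF transition(2)[OF chL(1) chM(1)]])

lemma F_has_derivative: "(F has_derivative \<iota> p) (at x\<^sub>0)"
  unfolding fd_F(2)[symmetric] by (rule fd_works[OF F_differentiable[OF x0_in_S]])

lemma push_eval:
  assumes "q \<in> cdom \<phi>" "q \<in> cdom \<psi>"
  shows "push p V (cmap \<phi> q) = to_coords M \<psi> q (\<iota> q (V q))"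
  unfolding push_def fd_F(1) incl_coords(2)[OF chL(1) chM(1) assms]
  by (simp add: field_coords_def cinv_atlas[OF L chL(1) assms(1)])

lemma push_at: "push p V x\<^sub>0 = \<iota> p (V p)"
  unfolding push_def fd_F(2) field_coords_chart_at[OF L p] by (rule refl)

lemma field_has_derivative:
  "vector_field L V \<Longrightarrow> (field_coords L \<phi> V has_derivative fd (field_coords L \<phi> V) x\<^sub>0) (at x\<^sub>0)"
  by (rule fd_works, rule smooth_on_differentiable[OF vector_fieldD[OF L _ chL(1)]])
    (use chL(2) in auto)

text \<open>The first term is the second derivative of the inclusion in coordinates, the second the
  image of the coordinate derivative of \<open>V\<close>.\<close>

lemma push_has_derivative:
  assumes "vector_field L V"
  shows "(push p V has_derivative
    (\<lambda>w. fd (\<lambda>y. fd F y (V p)) x\<^sub>0 w + \<iota> p (fd (field_coords L \<phi> V) x\<^sub>0 w))) (at x\<^sub>0)"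
proof -
  note tr = transition[OF chL(1) chM(1)]
  have "((\<lambda>x. fd F x (field_coords L \<phi> V x)) has_derivative
      (\<lambda>w. fd (\<lambda>y. fd F y (field_coords L \<phi> V x\<^sub>0)) x\<^sub>0 w + fd F x\<^sub>0 (fd (field_coords L \<phi> V) x\<^sub>0 w))) (at x\<^sub>0)"
  proof (rule has_derivative_linear_apply[OF tr(1) x0_in_S _ _ field_has_derivative[OF assms]])
    show "linear (fd F x)" if "x \<in> S" for x by (rule linear_fd[OF F_differentiable[OF that]])
    show "(\<lambda>x. fd F x i) differentiable at x\<^sub>0" for i
      by (rule smooth_on_differentiable[OF smooth_on_fd[OF tr(1,2) smooth_on_const[OF tr(1)]] x0_in_S])
  qed
  then show ?thesis unfolding push_def[abs_def] fd_F(2) field_coords_chart_at[OF L p] .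
qed

lemma levi_civita_push:
  "levi_civita_along M g L U V p =
    fd (push p V) x\<^sub>0 (U p) + christoffel M g p (\<iota> p (U p)) (\<iota> p (V p))"
proof -
  have "fd ((\<lambda>q. to_coords M \<psi> q (\<iota> q (V q))) \<circ> cinv \<phi>) x\<^sub>0 = fd (push p V) x\<^sub>0"
    by (rule fd_cong[OF transition(1)[OF chL(1) chM(1)] x0_in_S])
      (auto simp: push_eval cinv_atlas[OF L chL(1)])
  then show ?thesis by (simp add: levi_civita_along_def)
qed

text \<open>The second derivative of the inclusion is symmetric and cancels, leaving the image of
  the coordinate formula for the bracket.\<close>

lemma push_commute:
  assumes "vector_field L U" "vector_field L V"
  shows "fd (push p V) x\<^sub>0 (U p) - fd (push p U) x\<^sub>0 (V p) = \<iota> p (lie_bracket L U V p)"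
proof -
  have "Ck_on (Suc (Suc 0)) S F" by (rule smooth_onD[OF transition(2)[OF chL(1) chM(1)]])
  from mixed_derivatives[OF transition(1)[OF chL(1) chM(1)] x0_in_S this]
  show ?thesis
    unfolding fd_eqI[OF push_has_derivative[OF assms(1)]] fd_eqI[OF push_has_derivative[OF assms(2)]]
    by (simp add: lie_bracket_def Let_def linear_diff[OF linear_incl[OF p]])
qed

lemma christoffel_M:
  "christoffel M g p u v = christoffel M g p v u"
  "fd (\<lambda>x. tensor_coords M \<psi> g x u v) (cmap \<psi> p) w
     = g p (christoffel M g p w u) v + g p u (christoffel M g p w v)"
  by (rule christoffel[OF M sym_g carrier_L[OF p] nondegenerate_g[OF carrier_L[OF p]]]; assumption)+

lemma levi_civita_torsion_free:
  assumes "vector_field L U" "vector_field L V"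
  shows "levi_civita_along M g L U V p - levi_civita_along M g L V U p = \<iota> p (lie_bracket L U V p)"
  unfolding levi_civita_push push_commute[OF assms, symmetric] christoffel_M(1)[of "\<iota> p (U p)"]
  by simp

text \<open>Metric compatibility along \<open>L\<close>, with \<open>D w\<close> equal to
  \<open>g(\<nabla>_w Y, Z) + g(Y, \<nabla>_w Z)\<close>. It is stated as a full derivative because
  differentiability is also needed for the Killing equation.\<close>

lemma levi_civita_metric:
  assumes "vector_field L Y" "vector_field L Z"
  defines "D \<equiv> \<lambda>w. g p (fd (push p Y) x\<^sub>0 w + christoffel M g p (\<iota> p w) (\<iota> p (Y p))) (\<iota> p (Z p))
    + g p (\<iota> p (Y p)) (fd (push p Z) x\<^sub>0 w + christoffel M g p (\<iota> p w) (\<iota> p (Z p)))"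
  shows "((\<lambda>q. pullback q (Y q) (Z q)) \<circ> cinv \<phi> has_derivative D) (at x\<^sub>0)"
proof -
  note tr = transition[OF chL(1) chM(1)]
  let ?G = "\<lambda>x. tensor_coords M \<psi> g (F x)"
  have dG: "((\<lambda>x. ?G x u v) has_derivative
      (\<lambda>w. g p (christoffel M g p (\<iota> p w) u) v + g p u (christoffel M g p (\<iota> p w) v))) (at x\<^sub>0)" for u v
  proof -
    have "((\<lambda>y. tensor_coords M \<psi> g y u v) has_derivative
        fd (\<lambda>y. tensor_coords M \<psi> g y u v) (F x\<^sub>0)) (at (F x\<^sub>0))"
      unfolding F_eval[OF chL(2)]
      by (rule fd_works, rule smooth_on_differentiable[OF symmetric_tensor_fieldD(3)[OF M sym_g chM(1)]])
        (use chM(2) in auto)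
    from diff_chain_at[OF F_has_derivative this]
    show ?thesis unfolding F_eval[OF chL(2)] by (simp add: o_def christoffel_M(2))
  qed
  have dp: "(push p V has_derivative fd (push p V) x\<^sub>0) (at x\<^sub>0)" if "vector_field L V" for V
    using push_has_derivative[OF that] by (intro fd_works) (auto simp: differentiable_def)
  have G0: "?G x\<^sub>0 = g p"
    unfolding F_eval[OF chL(2)] by (rule tensor_coords_chart_at[OF M carrier_L[OF p]])
  have "((\<lambda>x. ?G x (push p Y x) (push p Z x)) has_derivative
     (\<lambda>w. fd (\<lambda>y. ?G y (push p Y x\<^sub>0) (push p Z x\<^sub>0)) x\<^sub>0 w
        + ?G x\<^sub>0 (fd (push p Y) x\<^sub>0 w) (push p Z x\<^sub>0) + ?G x\<^sub>0 (push p Y x\<^sub>0) (fd (push p Z) x\<^sub>0 w))) (at x\<^sub>0)"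
  proof (rule has_derivative_bilinear_apply[OF tr(1) x0_in_S _ _ dp[OF assms(1)] dp[OF assms(2)],
        where G = ?G])
    show "bilinear (?G x)" if x: "x \<in> S" for x
    proof -
      obtain q where q: "q \<in> cdom \<phi>" "q \<in> cdom \<psi>" "x = cmap \<phi> q" using x by blast
      show ?thesis unfolding q(3) F_eval[OF q(1)] by (rule bilinear_g_coords[OF chM(1) q(2)])
    qed
    show "(\<lambda>x. ?G x i j) differentiable at x\<^sub>0" for i j using dG by (auto simp: differentiable_def)
  qed
  \<comment> \<open>Differentiating the coefficients of \<open>g\<close> contributes the two
    Christoffel terms; at \<open>p\<close> itself the coefficients are just
    \<open>g p\<close>.\<close>
  then have "((\<lambda>x. ?G x (push p Y x) (push p Z x)) has_derivative D) (at x\<^sub>0)"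
    unfolding G0 push_at fd_eqI[OF dG] D_def
    by (simp add: bilinear_ladd[OF bilinear_g[OF carrier_L[OF p]]]
        bilinear_radd[OF bilinear_g[OF carrier_L[OF p]]] algebra_simps)
  then show ?thesis
  proof (rule has_derivative_transform_within_open[OF _ tr(1) x0_in_S])
    fix x assume "x \<in> S"
    then obtain q where q: "q \<in> cdom \<phi>" "q \<in> cdom \<psi>" "x = cmap \<phi> q" by blast
    show "?G x (push p Y x) (push p Z x) = ((\<lambda>q. pullback q (Y q) (Z q)) \<circ> cinv \<phi>) x"
      unfolding q(3) push_eval[OF q(1,2)] F_eval[OF q(1)] o_apply cinv_atlas[OF L chL(1) q(1)]
        pullback_def
      by (rule tensor_coords_eval(2)[OF M chM(1) q(2), symmetric])
  qed
qed

lemma dir_deriv_pullback: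
  assumes "vector_field L Y" "vector_field L Z"
  shows "dir_deriv L (\<lambda>q. pullback q (Y q) (Z q)) p (X p) =
    g p (levi_civita_along M g L X Y p) (\<iota> p (Z p)) + g p (\<iota> p (Y p)) (levi_civita_along M g L X Z p)"
  unfolding levi_civita_push by (rule dir_deriv_eqI[OF levi_civita_metric[OF assms]])

text \<open>Near \<open>p\<close> the function \<open>\<omega> q (Y q)\<close> is the coordinate
  form of \<open>\<alpha>\<close> applied to \<open>push p Y\<close>. The product rule yields the
  partial derivatives of the components of \<open>\<alpha>\<close>, as they occur in
  \<open>ext_deriv\<close>.\<close>

lemma rigged_form_has_derivative:
  assumes "vector_field L Y"
  shows "((\<lambda>q. \<omega> q (Y q)) \<circ> cinv \<phi> has_derivative
    (\<lambda>w. fd (\<lambda>y. form_coords M \<psi> \<alpha> y (\<iota> p (Y p))) (cmap \<psi> p) (\<iota> p w) + \<alpha> p (fd (push p Y) x\<^sub>0 w))) (at x\<^sub>0)"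
proof -
  note tr = transition[OF chL(1) chM(1)]
  let ?A = "\<lambda>x. form_coords M \<psi> \<alpha> (F x)"
  have dA: "((\<lambda>x. ?A x v) has_derivative
      (\<lambda>w. fd (\<lambda>y. form_coords M \<psi> \<alpha> y v) (cmap \<psi> p) (\<iota> p w))) (at x\<^sub>0)" for v
  proof -
    have "((\<lambda>y. form_coords M \<psi> \<alpha> y v) has_derivative
        fd (\<lambda>y. form_coords M \<psi> \<alpha> y v) (F x\<^sub>0)) (at (F x\<^sub>0))"
      unfolding F_eval[OF chL(2)]
      by (rule fd_works, rule smooth_on_differentiable[OF smooth_rigging_form_coords[OF chM(1)]])
        (use chM(2) carrier_W[OF p] in auto)
    from diff_chain_at[OF F_has_derivative this]
    show ?thesis unfolding F_eval[OF chL(2)] by (simp add: o_def)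
  qed
  have dp: "(push p Y has_derivative fd (push p Y) x\<^sub>0) (at x\<^sub>0)"
    using push_has_derivative[OF assms] by (intro fd_works) (auto simp: differentiable_def)
  have A0: "?A x\<^sub>0 v = \<alpha> p v" for v
    unfolding F_eval[OF chL(2)] form_coords_def cinv_atlas[OF M chM]
      coords_chart_at[OF M carrier_L[OF p]] by (rule refl)
  have "((\<lambda>x. ?A x (push p Y x)) has_derivative
     (\<lambda>w. fd (\<lambda>y. ?A y (push p Y x\<^sub>0)) x\<^sub>0 w + ?A x\<^sub>0 (fd (push p Y) x\<^sub>0 w))) (at x\<^sub>0)"
  proof (rule has_derivative_linear_apply[OF tr(1) x0_in_S _ _ dp, where B = ?A])
    show "linear (?A x)" if x: "x \<in> S" for x
    proof -
      obtain q where q: "q \<in> cdom \<phi>" "q \<in> cdom \<psi>" "x = cmap \<phi> q" using x by blast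
      show ?thesis unfolding q(3) F_eval[OF q(1)] by (rule linear_rigging_form_coords[OF chM(1) q(2)])
    qed
    show "(\<lambda>x. ?A x i) differentiable at x\<^sub>0" for i using dA by (auto simp: differentiable_def)
  qed
  then have "((\<lambda>x. ?A x (push p Y x)) has_derivative (\<lambda>w. fd (\<lambda>y. form_coords M \<psi> \<alpha> y (\<iota> p (Y p)))
      (cmap \<psi> p) (\<iota> p w) + \<alpha> p (fd (push p Y) x\<^sub>0 w))) (at x\<^sub>0)"
    unfolding A0 push_at fd_eqI[OF dA] .
  then show ?thesis
  proof (rule has_derivative_transform_within_open[OF _ tr(1) x0_in_S])
    fix x assume "x \<in> S"
    then obtain q where q: "q \<in> cdom \<phi>" "q \<in> cdom \<psi>" "x = cmap \<phi> q" by blast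
    show "?A x (push p Y x) = ((\<lambda>q. \<omega> q (Y q)) \<circ> cinv \<phi>) x"
      unfolding q(3) push_eval[OF q(1,2)] F_eval[OF q(1)] o_apply cinv_atlas[OF L chL(1) q(1)]
        form_coords_def cinv_atlas[OF M chM(1) q(2)] to_from_coords[OF M chM(1) q(2)] rigged_form_def
      by (rule refl)
  qed
qed

text \<open>Cartan's formula for the exterior derivative of \<open>\<omega>\<close>, combined with
  its naturality under pullback. The derivatives of the pushed fields form the bracket by
  \<open>push_commute\<close>, and only those of \<open>\<alpha>\<close> remain.\<close>

lemma rigged_form_exterior:
  assumes "vector_field L U" "vector_field L V"
  shows "dir_deriv L (\<lambda>q. \<omega> q (V q)) p (U p) - dir_deriv L (\<lambda>q. \<omega> q (U q)) p (V p)
    - \<omega> p (lie_bracket L U V p) = ext_deriv M \<alpha> p (\<iota> p (U p)) (\<iota> p (V p))"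
proof -
  have "linear (\<alpha> p)"
    using bilinear_linear_right[OF bilinear_g[OF carrier_L[OF p]]] by (simp add: rigging_form_def[abs_def])
  then show ?thesis
    unfolding dir_deriv_eqI[OF rigged_form_has_derivative[OF assms(1)]]
      dir_deriv_eqI[OF rigged_form_has_derivative[OF assms(2)]]
    unfolding rigged_form_def push_commute[OF assms, symmetric]
    by (simp add: ext_deriv_def Let_def linear_diff)
qed

text \<open>Metric compatibility produces derivatives in direction \<open>X\<close>; replacing each
  bracket by a difference of covariant derivatives trades them for derivatives of
  \<open>X\<close>.\<close>

lemma lie_deriv_pullback:
  assumes "vector_field L X" "vector_field L Y" "vector_field L Z"
  shows "lie_deriv_metric L X pullback Y Z p =
    g p (levi_civita_along M g L Y X p) (\<iota> p (Z p)) + g p (\<iota> p (Y p)) (levi_civita_along M g L Z X p)"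
  unfolding lie_deriv_metric_def dir_deriv_pullback[OF assms(2,3)]
  unfolding pullback_def levi_civita_torsion_free[OF assms(1,2), symmetric] levi_civita_torsion_free[OF assms(1,3), symmetric]
  by (simp add: bilinear_lsub[OF bilinear_g[OF carrier_L[OF p]]]
      bilinear_rsub[OF bilinear_g[OF carrier_L[OF p]]])

end

end

section \<open>Orbits and leaves\<close>

lemma open_curve_preimage:
  assumes "open I" "continuous_map (top_of_set I) (topo L) c" "openin (topo L) U"
  shows "open {t \<in> I. c t \<in> U}"
proof -
  have "openin (top_of_set I) {t \<in> topspace (top_of_set I). c t \<in> U}"
    by (rule openin_continuous_map_preimage[OF assms(2,3)])
  then show ?thesis using assms(1) by (simp add: openin_open_eq)
qed

lemma curve_in_carrier: "continuous_map (top_of_set I) (topo L) c \<Longrightarrow> t \<in> I \<Longrightarrow> c t \<in> carrier L"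
  unfolding continuous_map_def by auto

lemma curve_change_chart:
  assumes L: "smooth_manifold L" and c: "open I" "continuous_map (top_of_set I) (topo L) c" "t \<in> I"
    and ch: "\<phi> \<in> atlas L" "\<psi> \<in> atlas L" "c t \<in> cdom \<phi>" "c t \<in> cdom \<psi>"
    and d: "((cmap \<psi> \<circ> c) has_vector_derivative v) (at t)"
  shows "((cmap \<phi> \<circ> c) has_vector_derivative tmap \<psi> \<phi> (c t) v) (at t)"
proof -
  note comp = compat_atlas[OF L ch(2,1)]
  let ?J = "{t \<in> I. c t \<in> cdom \<psi>}"
  have "((cmap \<phi> \<circ> cinv \<psi>) \<circ> (cmap \<psi> \<circ> c) has_derivative tmap \<psi> \<phi> (c t) \<circ> (\<lambda>h. h *\<^sub>R v)) (at t)"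
    using d tmap_has_derivative[OF comp ch(4,3)]
    by (intro diff_chain_at) (simp_all add: has_vector_derivative_def)
  then have "((cmap \<phi> \<circ> c) has_derivative tmap \<psi> \<phi> (c t) \<circ> (\<lambda>h. h *\<^sub>R v)) (at t)"
    by (rule has_derivative_transform_within_open[of _ _ _ _ ?J])
      (use c ch chart_dom[OF L ch(2)] in \<open>auto simp: cinv_atlas[OF L ch(2)] intro: open_curve_preimage\<close>)
  then show ?thesis
    by (simp add: has_vector_derivative_def o_def linear_cmul[OF tmap_linear[OF comp ch(4,3)]])
qed

text \<open>Bootstrapping: in a chart the curve solves a differential equation with smooth
  right-hand side, so each order of differentiability of the curve passes to its derivative.\<close>

lemma integral_curve_smooth:
  assumes L: "smooth_manifold L" and X: "vector_field L X" and "open I" "integral_curve L X I c"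
  shows "smooth_curve L I c" "t \<in> I \<Longrightarrow> velocity L c t = X (c t)"
proof -
  have c: "continuous_map (top_of_set I) (topo L) c"
    "\<And>t. t \<in> I \<Longrightarrow> ((cmap (chart_at L (c t)) \<circ> c) has_vector_derivative X (c t)) (at t)"
    using assms(4) by (auto simp: integral_curve_def)
  show "velocity L c t = X (c t)" if "t \<in> I"
    using c(2)[OF that] by (simp add: velocity_def vector_derivative_at)
  have "Ck_on k {t \<in> I. c t \<in> cdom \<phi>} (cmap \<phi> \<circ> c)" if \<phi>: "\<phi> \<in> atlas L" for \<phi> k
  proof -
    let ?J = "{t \<in> I. c t \<in> cdom \<phi>}" and ?X = "field_coords L \<phi> X"
    have J: "open ?J" by (rule open_curve_preimage[OF assms(3) c(1) chart_dom[OF L \<phi>]])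
    have d: "((cmap \<phi> \<circ> c) has_derivative (\<lambda>h. h *\<^sub>R ?X ((cmap \<phi> \<circ> c) t))) (at t)" if t: "t \<in> ?J" for t
    proof -
      have "c t \<in> carrier L" using curve_in_carrier[OF c(1)] t by simp
      note ch = chart_at[OF L this]
      have "((cmap \<phi> \<circ> c) has_vector_derivative tmap (chart_at L (c t)) \<phi> (c t) (X (c t))) (at t)"
        by (rule curve_change_chart[OF L assms(3) c(1) _ \<phi> ch(1) _ ch(2) c(2)]) (use t in auto)
      moreover have "tmap (chart_at L (c t)) \<phi> (c t) (X (c t)) = ?X ((cmap \<phi> \<circ> c) t)"
        using t by (simp add: field_coords_def to_coords_tmap cinv_atlas[OF L \<phi>])
      ultimately show ?thesis by (simp add: has_vector_derivative_def)
    qed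
    show ?thesis
    proof (induction k)
      case 0
      have "continuous (at t) (cmap \<phi> \<circ> c)" if "t \<in> ?J" for t
        by (rule has_derivative_continuous[OF d[OF that]])
      then show ?case unfolding Ck_on.simps by (intro continuous_at_imp_continuous_on ballI)
    next
      case (Suc k)
      show ?case
      proof (rule Ck_on_Suc_intro[OF d J])
        have "Ck_on k ?J (\<lambda>t. ?X ((cmap \<phi> \<circ> c) t))"
          by (rule Ck_on_compose[OF J chart_image_open'[OF L \<phi>] _ Suc.IH smooth_onD[OF vector_fieldD[OF L X \<phi>]]])
            auto
        then show "Ck_on k ?J (\<lambda>t. h *\<^sub>R ?X ((cmap \<phi> \<circ> c) t))" for h
          by (rule Ck_on_bounded_linear[OF bounded_linear_scaleR_right J])
      qed
    qed
  qed
  then show "smooth_curve L I c" using c(1) by (auto simp: smooth_curve_def smooth_on_def)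
qed

lemma smooth_curve_velocity:
  assumes L: "smooth_manifold L" and c: "open I" "smooth_curve L I c" "t \<in> I"
  shows "((cmap (chart_at L (c t)) \<circ> c) has_vector_derivative velocity L c t) (at t)"
proof -
  have cc: "continuous_map (top_of_set I) (topo L) c" using c(2) by (simp add: smooth_curve_def)
  note ch = chart_at[OF L curve_in_carrier[OF cc c(3)]]
  have "smooth_on {s \<in> I. c s \<in> cdom (chart_at L (c t))} (cmap (chart_at L (c t)) \<circ> c)"
    using c(2) ch(1) by (auto simp: smooth_curve_def)
  then have "(cmap (chart_at L (c t)) \<circ> c) differentiable at t"
    by (rule smooth_on_differentiable) (use c(3) ch(2) in auto)
  then show ?thesis unfolding velocity_def by (simp add: vector_derivative_works)
qed

text \<open>The stored velocity refers to a chart that changes along the curve. Near a given time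
  one fixed chart is used instead, where both the velocity and the form have smooth
  components.\<close>

lemma continuous_form_velocity:
  fixes L :: "('a, 'f::euclidean_space) manifold" and \<omega> :: "'a \<Rightarrow> 'f \<Rightarrow> real"
  assumes L: "smooth_manifold L" and c: "open I" "smooth_curve L I c"
    and lin: "\<And>q. q \<in> carrier L \<Longrightarrow> linear (\<omega> q)"
    and sm: "\<And>\<phi> u. \<phi> \<in> atlas L \<Longrightarrow> smooth_on (cmap \<phi> ` cdom \<phi>) (\<lambda>x. form_coords L \<phi> \<omega> x u)"
  shows "continuous_on I (\<lambda>t. \<omega> (c t) (velocity L c t))"
proof (rule continuous_at_imp_continuous_on, rule ballI)
  fix t assume t: "t \<in> I"
  have cc: "continuous_map (top_of_set I) (topo L) c" using c(2) by (simp add: smooth_curve_def)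
  define \<phi> where "\<phi> = chart_at L (c t)"
  have ch: "\<phi> \<in> atlas L" "c t \<in> cdom \<phi>"
    using chart_at[OF L curve_in_carrier[OF cc t]] by (auto simp: \<phi>_def)
  let ?J = "{s \<in> I. c s \<in> cdom \<phi>}" and ?\<gamma> = "cmap \<phi> \<circ> c"
  have J: "open ?J" by (rule open_curve_preimage[OF c(1) cc chart_dom[OF L ch(1)]])
  have sm\<gamma>: "smooth_on ?J ?\<gamma>" using c(2) ch(1) by (simp add: smooth_curve_def)
  have fr: "linear (form_coords L \<phi> \<omega> (?\<gamma> s))" if "s \<in> ?J" for s
    using linear_compose[OF linear_from_coords[OF L ch(1)] lin[OF chart_dom_subset[OF L ch(1)]], of "c s"] that
    by (simp add: o_def form_coords_def[abs_def] cinv_atlas[OF L ch(1)])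
  have "smooth_on ?J (\<lambda>s. form_coords L \<phi> \<omega> (?\<gamma> s) (fd ?\<gamma> s 1))"
  proof (rule smooth_on_linear_apply[OF J, where B = "\<lambda>s. form_coords L \<phi> \<omega> (?\<gamma> s)"])
    show "smooth_on ?J (\<lambda>s. form_coords L \<phi> \<omega> (?\<gamma> s) i)" for i
      by (rule smooth_on_compose[OF J chart_image_open'[OF L ch(1)] _ sm\<gamma> sm[OF ch(1)]]) auto
    show "smooth_on ?J (\<lambda>s. fd ?\<gamma> s 1)"
      by (rule smooth_on_fd[OF J sm\<gamma> smooth_on_const[OF J]])
  qed (rule fr)
  then have "continuous_on ?J (\<lambda>s. form_coords L \<phi> \<omega> (?\<gamma> s) (fd ?\<gamma> s 1))"
    by (rule smooth_on_continuous_on)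
  moreover have "form_coords L \<phi> \<omega> (?\<gamma> s) (fd ?\<gamma> s 1) = \<omega> (c s) (velocity L c s)" if s: "s \<in> ?J" for s
  proof -
    have sI: "s \<in> I" "c s \<in> cdom \<phi>" using s by auto
    note cs = chart_at[OF L curve_in_carrier[OF cc sI(1)]]
    have "(?\<gamma> has_vector_derivative to_coords L \<phi> (c s) (velocity L c s)) (at s)"
      unfolding to_coords_tmap
      by (rule curve_change_chart[OF L c(1) cc sI(1) ch(1) cs(1) sI(2) cs(2)
            smooth_curve_velocity[OF L c sI(1)]])
    then have "fd ?\<gamma> s 1 = to_coords L \<phi> (c s) (velocity L c s)"
      by (simp add: has_vector_derivative_def fd_eqI)
    then show ?thesis
      by (simp add: form_coords_def cinv_atlas[OF L ch(1) sI(2)] to_from_coords[OF L ch(1) sI(2)])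
  qed
  ultimately have "continuous_on ?J (\<lambda>s. \<omega> (c s) (velocity L c s))"
    by (rule continuous_on_eq)
  then show "continuous (at t) (\<lambda>t. \<omega> (c t) (velocity L c t))"
    using t ch(2) J by (simp add: continuous_on_eq_continuous_at)
qed

text \<open>\<open>\<sigma>\<close> inverts an antiderivative \<open>\<tau>\<close> of
  \<open>f\<close>. The sign of \<open>f\<close> is left open, so \<open>\<tau>\<close> may reverse
  the order of \<open>s\<close> and \<open>t\<close>.\<close>

lemma nonvanishing_antiderivative_inverse:
  fixes f :: "real \<Rightarrow> real"
  assumes f: "continuous_on {a<..<b} f" "\<And>r. r \<in> {a<..<b} \<Longrightarrow> f r \<noteq> 0"
    and st: "s \<in> {a<..<b}" "t \<in> {a<..<b}"
  shows "\<exists>\<sigma> a' b' s' t'. s' \<in> {a'<..<b'} \<and> t' \<in> {a'<..<b'} \<and> \<sigma> s' = s \<and> \<sigma> t' = t \<and>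
    (\<forall>r\<in>{a'<..<b'}. \<sigma> r \<in> {a<..<b} \<and> (\<sigma> has_real_derivative 1 / f (\<sigma> r)) (at r))"
proof -
  \<comment> \<open>Midpoints towards the ends: a compact interval inside the domain of
    \<open>f\<close>, with \<open>s\<close> and \<open>t\<close> in its interior.\<close>
  define l where "l = (a + min s t) / 2"
  define u where "u = (b + max s t) / 2"
  have lu: "a < l" "l < s" "l < t" "s < u" "t < u" "u < b" using st by (auto simp: l_def u_def)
  let ?I = "{l<..<u}"
  have "continuous_on {l..u} f" by (rule continuous_on_subset[OF f(1)]) (use lu in auto)
  then obtain \<tau> where \<tau>: "\<forall>x\<in>{l..u}. (\<tau> has_vector_derivative f x) (at x within {l..u})"
    by (rule antiderivative_continuous) blast
  have d\<tau>: "(\<tau> has_real_derivative f x) (at x)" if "x \<in> ?I" for x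
  proof -
    have "(\<tau> has_vector_derivative f x) (at x within ?I)"
      by (rule has_vector_derivative_within_subset[OF bspec[OF \<tau>, of x]]) (use that in auto)
    then show ?thesis
      using that by (simp add: at_within_open[of x ?I] has_real_derivative_iff_has_vector_derivative)
  qed
  \<comment> \<open>Rolle's argument gives injectivity for either sign of \<open>f\<close>;
    invariance of domain then makes the image of \<open>\<tau>\<close> open.\<close>
  have less: "\<tau> x \<noteq> \<tau> y" if "x \<in> ?I" "y \<in> ?I" "x < y" for x y
  proof
    assume "\<tau> x = \<tau> y"
    have "\<exists>z. x < z \<and> z < y \<and> \<tau> y - \<tau> x = (y - x) * f z"
      by (rule MVT2[OF that(3)]) (use that d\<tau> in auto)
    then obtain z where "x < z" "z < y" "f z = 0" using \<open>\<tau> x = \<tau> y\<close> by auto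
    then show False using f(2)[of z] that lu by auto
  qed
  then have inj: "inj_on \<tau> ?I" by (intro linorder_inj_onI) auto
  have cont: "continuous_on ?I \<tau>"
    by (intro continuous_at_imp_continuous_on ballI DERIV_isCont[OF d\<tau>])
  have opU: "open (\<tau> ` ?I)" by (rule invariance_of_domain[OF cont _ inj]) simp
  have conU: "connected (\<tau> ` ?I)" by (rule connected_continuous_image[OF cont]) simp
  define \<sigma> where "\<sigma> = inv_into ?I \<tau>"
  have \<sigma>: "\<sigma> (\<tau> x) = x" if "x \<in> ?I" for x using inj that by (simp add: \<sigma>_def)
  have d\<sigma>: "(\<sigma> has_real_derivative 1 / f x) (at (\<tau> x))" if "x \<in> ?I" for x
  proof -
    have "f x \<noteq> 0" using f(2)[of x] that lu by auto
    then have id: "(*) (f x) \<circ> (\<lambda>h. h / f x) = id" by (auto simp: fun_eq_iff)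
    have "(\<sigma> has_derivative (\<lambda>h. h / f x)) (at (\<tau> x))"
      by (rule has_derivative_inverse_on[where S = ?I and f = \<tau> and f' = "\<lambda>x. (*) (f x)"
            and g' = "\<lambda>x h. h / f x", OF _ _ \<sigma> id that])
        (use d\<tau> in \<open>auto simp: has_field_derivative_def\<close>)
    then show ?thesis by (rule has_derivative_imp_has_field_derivative) simp
  qed
  have in_U: "\<tau> s \<in> \<tau> ` ?I" "\<tau> t \<in> \<tau> ` ?I" using lu by auto
  obtain e1 where e1: "e1 > 0" "ball (\<tau> s) e1 \<subseteq> \<tau> ` ?I" using opU in_U open_contains_ball by blast
  obtain e2 where e2: "e2 > 0" "ball (\<tau> t) e2 \<subseteq> \<tau> ` ?I" using opU in_U open_contains_ball by blast
  define e where "e = min e1 e2"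
  define a' where "a' = min (\<tau> s) (\<tau> t) - e"
  define b' where "b' = max (\<tau> s) (\<tau> t) + e"
  \<comment> \<open>Between \<open>\<tau> s\<close> and \<open>\<tau> t\<close> connectedness of the
    image suffices; the overhang of length \<open>e\<close> at either end lies in one of the two
    balls.\<close>
  have sub: "r \<in> \<tau> ` ?I" if r: "r \<in> {a'<..<b'}" for r
  proof -
    have "r \<in> ball (\<tau> s) e1 \<or> r \<in> ball (\<tau> t) e2 \<or> r \<in> {min (\<tau> s) (\<tau> t)..max (\<tau> s) (\<tau> t)}"
      using r by (auto simp: a'_def b'_def e_def dist_real_def min_def max_def abs_if split: if_splits)
    then consider "r \<in> ball (\<tau> s) e1" | "r \<in> ball (\<tau> t) e2" | "r \<in> {min (\<tau> s) (\<tau> t)..max (\<tau> s) (\<tau> t)}"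
      by blast
    then show ?thesis
    proof cases
      case 3
      have "min (\<tau> s) (\<tau> t) \<in> \<tau> ` ?I" "max (\<tau> s) (\<tau> t) \<in> \<tau> ` ?I" using in_U by (auto simp: min_def max_def)
      then show ?thesis using 3 connected_contains_Icc[OF conU] by blast
    qed (use e1 e2 in auto)
  qed
  have "\<tau> s \<in> {a'<..<b'}" "\<tau> t \<in> {a'<..<b'}" using e1 e2 by (auto simp: a'_def b'_def e_def)
  moreover have "\<sigma> (\<tau> s) = s" "\<sigma> (\<tau> t) = t" using \<sigma> lu by auto
  moreover have "\<sigma> r \<in> {a<..<b} \<and> (\<sigma> has_real_derivative 1 / f (\<sigma> r)) (at r)"
    if r: "r \<in> {a'<..<b'}" for r
  proof -
    obtain x where "x \<in> ?I" "r = \<tau> x" using sub[OF r] by blast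
    then show ?thesis using lu \<sigma>[of x] d\<sigma>[of x] by auto
  qed
  ultimately show ?thesis by blast
qed

text \<open>Stated for any smooth one-form with \<open>\<omega>(X) = 1\<close>: such a form extracts
  the factor between the velocity of a tangent curve and \<open>X\<close>, and shows that this
  factor is continuous.\<close>

lemma flow_leaf_eq_orbit:
  fixes L :: "('a, 'f::euclidean_space) manifold" and \<omega> :: "'a \<Rightarrow> 'f \<Rightarrow> real"
  assumes L: "smooth_manifold L" and X: "vector_field L X"
    and lin: "\<And>q. q \<in> carrier L \<Longrightarrow> linear (\<omega> q)" and one: "\<And>q. q \<in> carrier L \<Longrightarrow> \<omega> q (X q) = 1"
    and sm: "\<And>\<phi> u. \<phi> \<in> atlas L \<Longrightarrow> smooth_on (cmap \<phi> ` cdom \<phi>) (\<lambda>x. form_coords L \<phi> \<omega> x u)"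
  shows "flow_leaf L (\<lambda>q. span {X q}) p = orbit L X p"
proof
  show "orbit L X p \<subseteq> flow_leaf L (\<lambda>q. span {X q}) p"
  proof
    fix z assume "z \<in> orbit L X p"
    then obtain c a b s t where c: "integral_curve L X {a<..<b} c" "s \<in> {a<..<b}" "t \<in> {a<..<b}"
      "c s = p" "z = c t" unfolding orbit_def by blast
    have X0: "X q \<noteq> 0" if "q \<in> carrier L" for q using one[OF that] linear_0[OF lin[OF that]] by auto
    have vel: "velocity L c r \<in> span {X (c r)}" "velocity L c r \<noteq> 0" if r: "r \<in> {a<..<b}" for r
    proof -
      have "continuous_map (top_of_set {a<..<b}) (topo L) c" using c(1) by (simp add: integral_curve_def)
      then have "c r \<in> carrier L" using curve_in_carrier r by blast
      then show "velocity L c r \<in> span {X (c r)}" "velocity L c r \<noteq> 0"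
        using integral_curve_smooth(2)[OF L X _ c(1) r] X0 by (auto intro: span_base)
    qed
    have "smooth_curve L {a<..<b} c" by (rule integral_curve_smooth(1)[OF L X _ c(1)]) simp
    then show "z \<in> flow_leaf L (\<lambda>q. span {X q}) p"
      unfolding flow_leaf_def using c vel by blast
  qed
  show "flow_leaf L (\<lambda>q. span {X q}) p \<subseteq> orbit L X p"
  proof
    fix z assume "z \<in> flow_leaf L (\<lambda>q. span {X q}) p"
    then obtain c a b s t where c: "smooth_curve L {a<..<b} c"
      "\<And>r. r \<in> {a<..<b} \<Longrightarrow> velocity L c r \<in> span {X (c r)} \<and> velocity L c r \<noteq> 0"
      "s \<in> {a<..<b}" "t \<in> {a<..<b}" "c s = p" "z = c t" unfolding flow_leaf_def by blast
    have cc: "continuous_map (top_of_set {a<..<b}) (topo L) c" using c(1) by (simp add: smooth_curve_def)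
    define f where "f = (\<lambda>r. \<omega> (c r) (velocity L c r))"
    have vel: "velocity L c r = f r *\<^sub>R X (c r)" "f r \<noteq> 0" if r: "r \<in> {a<..<b}" for r
    proof -
      have q: "c r \<in> carrier L" by (rule curve_in_carrier[OF cc r])
      obtain k where k: "velocity L c r = k *\<^sub>R X (c r)" using c(2)[OF r] by (auto simp: span_singleton)
      then have "f r = k" using one[OF q] by (simp add: f_def linear_cmul[OF lin[OF q]])
      then show "velocity L c r = f r *\<^sub>R X (c r)" "f r \<noteq> 0" using k c(2)[OF r] by auto
    qed
    have "continuous_on {a<..<b} f"
      unfolding f_def by (rule continuous_form_velocity[OF L _ c(1) lin sm]) simp_all
    then obtain \<sigma> a' b' s' t' where \<sigma>: "s' \<in> {a'<..<b'}" "t' \<in> {a'<..<b'}" "\<sigma> s' = s" "\<sigma> t' = t"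
      "\<forall>r\<in>{a'<..<b'}. \<sigma> r \<in> {a<..<b} \<and> (\<sigma> has_real_derivative 1 / f (\<sigma> r)) (at r)"
      using nonvanishing_antiderivative_inverse[where f = f, OF _ vel(2) c(3,4)] by blast
    have \<sigma>_in: "\<sigma> r \<in> {a<..<b}" and \<sigma>_deriv: "(\<sigma> has_real_derivative 1 / f (\<sigma> r)) (at r)"
      if "r \<in> {a'<..<b'}" for r
      using \<sigma>(5) that by auto
    have "integral_curve L X {a'<..<b'} (c \<circ> \<sigma>)"
      unfolding integral_curve_def
    proof (intro conjI ballI)
      have "continuous_on {a'<..<b'} \<sigma>"
        by (intro continuous_at_imp_continuous_on ballI DERIV_isCont[OF \<sigma>_deriv])
      then have "continuous_map (top_of_set {a'<..<b'}) (top_of_set {a<..<b}) \<sigma>"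
        using \<sigma>_in by (auto simp: continuous_map_in_subtopology)
      then show "continuous_map (top_of_set {a'<..<b'}) (topo L) (c \<circ> \<sigma>)"
        by (rule continuous_map_compose[OF _ cc])
      fix r assume r: "r \<in> {a'<..<b'}"
      have 1: "(\<sigma> has_vector_derivative 1 / f (\<sigma> r)) (at r)"
        using \<sigma>_deriv[OF r] by (simp add: has_real_derivative_iff_has_vector_derivative)
      have 2: "((cmap (chart_at L (c (\<sigma> r))) \<circ> c) has_vector_derivative f (\<sigma> r) *\<^sub>R X (c (\<sigma> r))) (at (\<sigma> r))"
        using smooth_curve_velocity[OF L _ c(1) \<sigma>_in[OF r]] vel(1)[OF \<sigma>_in[OF r]] by simp
      \<comment> \<open>The inner derivative \<open>1 / f\<close> cancels the speed
        \<open>f\<close>.\<close>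
      show "((cmap (chart_at L ((c \<circ> \<sigma>) r)) \<circ> (c \<circ> \<sigma>)) has_vector_derivative X ((c \<circ> \<sigma>) r)) (at r)"
        using vector_diff_chain_at[OF 1 2] vel(2)[OF \<sigma>_in[OF r]] by (simp add: o_def)
    qed
    then show "z \<in> orbit L X p"
      unfolding orbit_def using \<sigma>(1-4) c(5,6)
      by (intro CollectI exI[of _ "c \<circ> \<sigma>"] exI[of _ a'] exI[of _ b'] exI[of _ s'] exI[of _ t']) auto
  qed
qed


section \<open>The flow of the rigged vector field\<close>

context rigged_null_hypersurface
begin

abbreviation "D \<equiv> null_foliation \<xi>"

lemma in_D_iff:
  assumes "q \<in> carrier L"
  shows "u \<in> D q \<longleftrightarrow> u = \<omega> q u *\<^sub>R \<xi> q"
proof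
  assume "u \<in> D q"
  then obtain k where "u = k *\<^sub>R \<xi> q" by (auto simp: null_foliation_def span_singleton)
  then show "u = \<omega> q u *\<^sub>R \<xi> q" using xi_null(1)[OF assms] by (simp add: linear_cmul[OF linear_omega[OF assms]])
next
  assume "u = \<omega> q u *\<^sub>R \<xi> q"
  then show "u \<in> D q" by (metis null_foliation_def span_base span_scale singletonI)
qed

text \<open>Product rule for \<open>X = \<omega>(X) \<xi>\<close>. Only the shape modulo multiples
  of \<open>\<xi> p\<close> matters, so the coefficient \<open>a'\<close> is left
  unspecified.\<close>

lemma field_in_D_has_derivative:
  assumes X: "vector_field L X" "\<And>q. q \<in> carrier L \<Longrightarrow> X q \<in> D q" and p: "p \<in> carrier L"
  obtains a' where "fd (field_coords L (chart_at L p) X) (cmap (chart_at L p) p) =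
    (\<lambda>w. \<omega> p (X p) *\<^sub>R fd (field_coords L (chart_at L p) \<xi>) (cmap (chart_at L p) p) w + a' w *\<^sub>R \<xi> p)"
proof -
  let ?\<phi> = "chart_at L p"
  let ?x = "cmap ?\<phi> p"
  let ?a = "(\<lambda>q. \<omega> q (X q)) \<circ> cinv ?\<phi>"
  note ch = chart_at[OF L p]
  have a: "(?a has_derivative fd ?a ?x) (at ?x)"
    using rigged_form_has_derivative[OF p X(1)] by (intro fd_works) (auto simp: differentiable_def)
  have "((\<lambda>x. ?a x *\<^sub>R field_coords L ?\<phi> \<xi> x) has_derivative
      (\<lambda>w. ?a ?x *\<^sub>R fd (field_coords L ?\<phi> \<xi>) ?x w + fd ?a ?x w *\<^sub>R field_coords L ?\<phi> \<xi> ?x)) (at ?x)"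
    by (rule has_derivative_scaleR[OF a field_has_derivative[OF p xi_field]])
  then have "(field_coords L ?\<phi> X has_derivative
      (\<lambda>w. ?a ?x *\<^sub>R fd (field_coords L ?\<phi> \<xi>) ?x w + fd ?a ?x w *\<^sub>R field_coords L ?\<phi> \<xi> ?x)) (at ?x)"
  proof (rule has_derivative_transform_within_open[OF _ chart_image_open'[OF L ch(1)]])
    fix x assume "x \<in> cmap ?\<phi> ` cdom ?\<phi>"
    then obtain q where q: "q \<in> cdom ?\<phi>" "x = cmap ?\<phi> q" by blast
    have qL: "q \<in> carrier L" by (rule chart_dom_subset[OF L ch(1) q(1)])
    have "linear (to_coords L ?\<phi> q)"
      unfolding to_coords_tmap
      by (rule tmap_linear[OF compat_atlas[OF L chart_at(1)[OF L qL] ch(1)] chart_at(2)[OF L qL] q(1)])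
    moreover have "X q = \<omega> q (X q) *\<^sub>R \<xi> q" using X(2)[OF qL] in_D_iff[OF qL] by blast
    ultimately show "?a x *\<^sub>R field_coords L ?\<phi> \<xi> x = field_coords L ?\<phi> X x"
      unfolding q(2) field_coords_def o_apply cinv_atlas[OF L ch(1) q(1)] by (metis linear_cmul)
  qed (use ch(2) in auto)
  from fd_eqI[OF this] show ?thesis
    by (intro that[of "fd ?a ?x"]) (simp add: cinv_atlas[OF L ch] field_coords_chart_at[OF L p])
qed

text \<open>Both fields are proportional to \<open>\<xi>\<close> at \<open>p\<close>, so the terms
  containing the derivative of \<open>\<xi>\<close> cancel and a multiple of \<open>\<xi> p\<close>
  remains.\<close>

lemma lie_bracket_in_D:
  assumes "vector_field L X" "vector_field L Y"
    and "\<And>q. q \<in> carrier L \<Longrightarrow> X q \<in> D q" "\<And>q. q \<in> carrier L \<Longrightarrow> Y q \<in> D q" and p: "p \<in> carrier L"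
  shows "lie_bracket L X Y p \<in> D p"
proof -
  let ?d = "fd (field_coords L (chart_at L p) \<xi>) (cmap (chart_at L p) p)"
  obtain a' where a': "fd (field_coords L (chart_at L p) X) (cmap (chart_at L p) p) =
    (\<lambda>w. \<omega> p (X p) *\<^sub>R ?d w + a' w *\<^sub>R \<xi> p)"
    by (rule field_in_D_has_derivative[OF assms(1,3) p])
  obtain b' where b': "fd (field_coords L (chart_at L p) Y) (cmap (chart_at L p) p) =
    (\<lambda>w. \<omega> p (Y p) *\<^sub>R ?d w + b' w *\<^sub>R \<xi> p)"
    by (rule field_in_D_has_derivative[OF assms(2,4) p])
  define r where "r = \<omega> p (X p)"
  define s where "s = \<omega> p (Y p)"
  have XY: "X p = r *\<^sub>R \<xi> p" "Y p = s *\<^sub>R \<xi> p"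
    using assms(3,4)[OF p] in_D_iff[OF p] by (auto simp: r_def s_def)
  have lin: "linear ?d" by (rule has_derivative_linear[OF field_has_derivative[OF p xi_field]])
  have "lie_bracket L X Y p = s *\<^sub>R ?d (X p) + b' (X p) *\<^sub>R \<xi> p - (r *\<^sub>R ?d (Y p) + a' (Y p) *\<^sub>R \<xi> p)"
    by (simp add: lie_bracket_def Let_def a' b' r_def s_def)
  also have "s *\<^sub>R ?d (X p) = r *\<^sub>R ?d (Y p)" unfolding XY linear_cmul[OF lin] by simp
  finally have "lie_bracket L X Y p = (b' (X p) - a' (Y p)) *\<^sub>R \<xi> p" by (simp add: algebra_simps)
  then show ?thesis by (simp add: null_foliation_def span_base span_scale)
qed

lemma foliation_D: "foliation L 1 D"
  unfolding foliation_def
proof (intro conjI ballI allI impI)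
  fix p assume p: "p \<in> carrier L"
  show "subspace (D p)" by (simp add: null_foliation_def)
  show "dim (D p) = 1" using xi_nonzero[OF p] by (simp add: null_foliation_def dim_span dim_insert)
  show "\<exists>U X. openin (topo L) U \<and> p \<in> U \<and> (\<forall>i<(1::nat). vector_field_on L U (X i)) \<and>
      (\<forall>q\<in>U. D q = span ((\<lambda>i. X i q) ` {..<1}))"
    using p xi_field
    by (intro exI[of _ "carrier L"] exI[of _ "\<lambda>i::nat. \<xi>"]) (auto simp: null_foliation_def lessThan_Suc)
qed (use lie_bracket_in_D in blast)

text \<open>Since \<open>g\<^sub>r q z (\<xi> q) = \<omega> q z\<close>, the orthogonal
  representative of the coset of \<open>u\<close> is
  \<open>u - \<omega> q u *\<^sub>R \<xi> q\<close>. On it \<open>\<omega>\<close> vanishes, and the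
  correction lies in the radical of \<open>pullback\<close>.\<close>

lemma induced_normal_metric_eq:
  assumes q: "q \<in> carrier L"
  shows "induced_normal_metric g\<^sub>r D q (nproj D q u) (nproj D q v) = pullback q u v"
proof -
  note b = bilinear_rigged_metric[OF q] and lin = linear_omega[OF q] and pb = bilinear_pullback[OF q]
  have rep: "normal_rep g\<^sub>r D q (nproj D q u) = u - \<omega> q u *\<^sub>R \<xi> q" for u
    unfolding normal_rep_def
  proof (rule the_equality)
    have "u - \<omega> q u *\<^sub>R \<xi> q \<in> nproj D q u"
      unfolding nproj_def null_foliation_def
      by (rule image_eqI[of _ _ "- (\<omega> q u *\<^sub>R \<xi> q)"]) (auto intro: span_neg span_scale span_base)
    moreover have "g\<^sub>r q (u - \<omega> q u *\<^sub>R \<xi> q) w = 0" if "w \<in> D q" for w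
    proof -
      have w: "w = \<omega> q w *\<^sub>R \<xi> q" using that in_D_iff[OF q] by blast
      have "g\<^sub>r q z (\<xi> q) = \<omega> q z" for z
        using xi_null[OF q] pullback_sym[OF q, of z "\<xi> q"] by (simp add: rigged_metric_eq)
      then have "g\<^sub>r q (u - \<omega> q u *\<^sub>R \<xi> q) (\<xi> q) = 0"
        using xi_null(1)[OF q] by (simp add: linear_diff[OF lin] linear_cmul[OF lin])
      then show ?thesis using bilinear_rmul[OF b] by (subst w) simp
    qed
    ultimately show "u - \<omega> q u *\<^sub>R \<xi> q \<in> nproj D q u \<and> (\<forall>w\<in>D q. g\<^sub>r q (u - \<omega> q u *\<^sub>R \<xi> q) w = 0)"
      by blast
    fix z assume z: "z \<in> nproj D q u \<and> (\<forall>w\<in>D q. g\<^sub>r q z w = 0)"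
    then obtain k where k: "z = u + k *\<^sub>R \<xi> q"
      by (auto simp: nproj_def null_foliation_def span_singleton)
    have "g\<^sub>r q z (\<xi> q) = 0" using z by (simp add: null_foliation_def span_base)
    then have "\<omega> q z = 0"
      using xi_null[OF q] pullback_sym[OF q, of z "\<xi> q"] by (simp add: rigged_metric_eq)
    then have "k = - \<omega> q u"
      using xi_null(1)[OF q] k by (simp add: linear_add[OF lin] linear_cmul[OF lin])
    then show "z = u - \<omega> q u *\<^sub>R \<xi> q" using k by simp
  qed
  have xi': "pullback q z (\<xi> q) = 0" for z using xi_null(2)[OF q] pullback_sym[OF q, of z] by simp
  show ?thesis
    unfolding induced_normal_metric_def rep rigged_metric_eq
    by (simp add: bilinear_lsub[OF pb] bilinear_rsub[OF pb] bilinear_lmul[OF pb] bilinear_rmul[OF pb]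
        xi_null[OF q] xi' linear_diff[OF lin] linear_cmul[OF lin])
qed

lemma normal_metric_induced: "normal_metric L D (induced_normal_metric g\<^sub>r D)"
  unfolding normal_metric_def
proof (intro conjI ballI allI impI)
  let ?h = "\<lambda>p u v. induced_normal_metric g\<^sub>r D p (nproj D p u) (nproj D p v)"
  have eq: "?h q = pullback q" if "q \<in> carrier L" for q
    by (intro ext induced_normal_metric_eq that)
  show "symmetric_tensor_field L ?h"
    unfolding symmetric_tensor_field_def
  proof (intro conjI ballI allI)
    fix \<phi> u v assume \<phi>: "\<phi> \<in> atlas L"
    show "smooth_on (cmap \<phi> ` cdom \<phi>) (\<lambda>x. tensor_coords L \<phi> ?h x u v)"
    proof (rule smooth_on_cong[OF chart_image_open'[OF L \<phi>] _ smooth_pullback_coords(1)[OF \<phi>]])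
      fix x assume "x \<in> cmap \<phi> ` cdom \<phi>"
      then have "cinv \<phi> x \<in> carrier L" using chart_dom_subset[OF L \<phi>] cinv_atlas[OF L \<phi>] by auto
      then show "tensor_coords L \<phi> pullback x u v = tensor_coords L \<phi> ?h x u v"
        by (simp add: tensor_coords_def Let_def induced_normal_metric_eq)
    qed
  next
    fix p assume p: "p \<in> carrier L"
    show "bilinear (?h p)" unfolding eq[OF p] by (rule bilinear_pullback[OF p])
    show "?h p u v = ?h p v u" for u v unfolding induced_normal_metric_eq[OF p] by (rule pullback_sym[OF p])
  qed
  fix p u assume p: "p \<in> carrier L" and "nproj D p u \<noteq> nproj D p 0"
  \<comment> \<open>All vectors of \<open>D p\<close> share the zero coset, so a nonzero coset means
    \<open>u \<notin> D p\<close>, outside the kernel of \<open>pullback\<close>.\<close>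
  moreover have "nproj D p w = D p" if w: "w \<in> D p" for w
  proof -
    have sub: "subspace (D p)" by (simp add: null_foliation_def)
    have "y \<in> nproj D p w" if "y \<in> D p" for y
      unfolding nproj_def using subspace_diff[OF sub that w] by (intro image_eqI[of _ _ "y - w"]) auto
    then show ?thesis using subspace_add[OF sub w] by (auto simp: nproj_def)
  qed
  moreover have "0 \<in> D p" by (simp add: null_foliation_def span_zero)
  ultimately have "u \<notin> D p" by blast
  then show "?h p u u > 0"
    using pullback_definite[OF p xi_null[OF p], of u]
    by (auto simp: induced_normal_metric_eq[OF p] null_foliation_def less_le)
qed

end

section \<open>Consequences of total geodesy\<close>

locale totally_geodesic_rigged = rigged_null_hypersurface +
  assumes totally_geodesic: "totally_geodesic M g L \<xi>"
begin

text \<open>Differentiating \<open>g(X,Z) = 0\<close> along \<open>Y\<close> gives \<open>g(\<nabla>\<^sub>Y X, Z) = - g(X, \<nabla>\<^sub>Y Z) = - \<omega>(X) B(Y,Z)\<close>.\<close>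

lemma levi_civita_null_perp:
  assumes X: "vector_field L X" "\<And>q. q \<in> carrier L \<Longrightarrow> X q \<in> D q"
    and YZ: "vector_field L Y" "vector_field L Z" and p: "p \<in> carrier L"
  shows "g p (levi_civita_along M g L Y X p) (\<iota> p (Z p)) = 0"
proof -
  have X\<xi>: "X q = \<omega> q (X q) *\<^sub>R \<xi> q" if "q \<in> carrier L" for q using X(2)[OF that] in_D_iff[OF that] by blast
  have "pullback q (X q) v = 0" if "q \<in> carrier L" for q v
    by (subst X\<xi>[OF that]) (simp add: bilinear_lmul[OF bilinear_pullback[OF that]] xi_null[OF that])
  then have "dir_deriv L (\<lambda>q. pullback q (X q) (Z q)) p (Y p) = 0"
    by (rule dir_deriv_const[OF L p])
  moreover have "g p (\<iota> p (X p)) (levi_civita_along M g L Y Z p) = 0"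
  proof -
    have "g p (\<iota> p (\<xi> p)) (levi_civita_along M g L Y Z p) = 0"
      using totally_geodesic YZ p symmetric_g[OF carrier_L[OF p], of "\<iota> p (\<xi> p)"]
      by (simp add: totally_geodesic_def)
    then show ?thesis
      by (subst X\<xi>[OF p]) (simp add: linear_cmul[OF linear_incl[OF p]]
          bilinear_lmul[OF bilinear_g[OF carrier_L[OF p]]])
  qed
  ultimately show ?thesis using dir_deriv_pullback[OF p X(1) YZ(2), of Y] by simp
qed

lemma lie_deriv_pullback_zero:
  assumes X: "vector_field L X" "\<And>q. q \<in> carrier L \<Longrightarrow> X q \<in> D q"
    and YZ: "vector_field L Y" "vector_field L Z" and p: "p \<in> carrier L"
  shows "lie_deriv_metric L X pullback Y Z p = 0"
proof -
  have "g p (\<iota> p (Y p)) (levi_civita_along M g L Z X p) = 0"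
    using levi_civita_null_perp[OF X YZ(2,1) p] symmetric_g[OF carrier_L[OF p]] by metis
  then show ?thesis
    by (simp add: lie_deriv_pullback[OF p X(1) YZ] levi_civita_null_perp[OF X YZ p])
qed

lemma holonomy_invariant_induced: "holonomy_invariant L D (induced_normal_metric g\<^sub>r D)"
  unfolding holonomy_invariant_def
proof (intro allI impI ballI)
  fix X Y Z p
  assume *: "vector_field L X \<and> (\<forall>p\<in>carrier L. X p \<in> D p) \<and> vector_field L Y \<and> vector_field L Z"
    and p: "p \<in> carrier L"
  have "lie_deriv_normal L D X (induced_normal_metric g\<^sub>r D) Y Z p = lie_deriv_metric L X pullback Y Z p"
    \<comment> \<open>On cosets the induced metric is \<open>pullback\<close> throughout the
      carrier, so its values, and also its derivative along \<open>X\<close>, may be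
      replaced.\<close>
    unfolding lie_deriv_normal_def lie_deriv_metric_def induced_normal_metric_eq[OF p]
    using dir_deriv_cong[OF L p induced_normal_metric_eq] by simp
  also have "\<dots> = 0" using * p by (intro lie_deriv_pullback_zero) auto
  finally show "lie_deriv_normal L D X (induced_normal_metric g\<^sub>r D) Y Z p = 0" .
qed

lemma riemannian_flow_D: "riemannian_flow L D"
  unfolding riemannian_foliation_def
  using foliation_D normal_metric_induced holonomy_invariant_induced by blast

lemma bundle_like_rigged_metric: "bundle_like L D g\<^sub>r"
  unfolding bundle_like_def
  using riemannian_rigged_metric normal_metric_induced holonomy_invariant_induced by blast

lemma killing_xi:
  assumes closed: "closed_rigging M g W \<zeta>"
  shows "killing_field L g\<^sub>r \<xi>"
  unfolding killing_field_def
proof (intro conjI allI impI ballI xi_field)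
  fix Y Z p
  assume "vector_field L Y \<and> vector_field L Z" and p: "p \<in> carrier L"
  then have YZ: "vector_field L Y" "vector_field L Z" by auto
  \<comment> \<open>This says that the Lie derivative of \<open>\<omega>\<close> along
    \<open>\<xi>\<close> vanishes, evaluated on \<open>V\<close>.\<close>
  have d: "dir_deriv L (\<lambda>q. \<omega> q (V q)) p (\<xi> p) = \<omega> p (lie_bracket L \<xi> V p)"
    if V: "vector_field L V" for V
  proof -
    have "dir_deriv L (\<lambda>q. \<omega> q (\<xi> q)) p (V p) = 0"
      by (rule dir_deriv_const[OF L p]) (rule xi_null(1))
    moreover have "ext_deriv M \<alpha> p (\<iota> p (\<xi> p)) (\<iota> p (V p)) = 0"
      using closed carrier_W[OF p] by (simp add: closed_rigging_def)
    ultimately show ?thesis using rigged_form_exterior[OF p xi_field V] by simp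
  qed
  let ?x = "cmap (chart_at L p) p" and ?c = "cinv (chart_at L p)"
  have at_p: "?c ?x = p" by (rule cinv_atlas[OF L chart_at[OF L p]])
  let ?H = "(\<lambda>q. pullback q (Y q) (Z q)) \<circ> ?c"
  have dH: "(?H has_derivative fd ?H ?x) (at ?x)"
    using levi_civita_metric[OF p YZ] by (intro fd_works) (auto simp: differentiable_def)
  have dw: "((\<lambda>q. \<omega> q (V q)) \<circ> ?c has_derivative fd ((\<lambda>q. \<omega> q (V q)) \<circ> ?c) ?x) (at ?x)"
    if "vector_field L V" for V
    using rigged_form_has_derivative[OF p that] by (intro fd_works) (auto simp: differentiable_def)
  have "dir_deriv L (\<lambda>q. g\<^sub>r q (Y q) (Z q)) p (\<xi> p) = dir_deriv L (\<lambda>q. pullback q (Y q) (Z q)) p (\<xi> p)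
      + (\<omega> p (Y p) * dir_deriv L (\<lambda>q. \<omega> q (Z q)) p (\<xi> p)
        + dir_deriv L (\<lambda>q. \<omega> q (Y q)) p (\<xi> p) * \<omega> p (Z p))"
    using has_derivative_add[OF dH has_derivative_mult[OF dw[OF YZ(1)] dw[OF YZ(2)]]]
    by (subst dir_deriv_eqI) (simp_all add: o_def rigged_metric_eq dir_deriv_def at_p)
  \<comment> \<open>The derivatives of the two factors \<open>\<omega>\<close> cancel against the
    bracket terms by \<open>d\<close>, so only the degenerate part of the metric
    contributes.\<close>
  then have "lie_deriv_metric L \<xi> g\<^sub>r Y Z p = lie_deriv_metric L \<xi> pullback Y Z p"
    by (simp add: lie_deriv_metric_def rigged_metric_eq d YZ algebra_simps)
  also have "\<dots> = 0"
    by (rule lie_deriv_pullback_zero[OF xi_field _ YZ p]) (simp add: null_foliation_def span_base)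
  finally show "lie_deriv_metric L \<xi> g\<^sub>r Y Z p = 0" .
qed

lemma isometric_flow_D:
  assumes "closed_rigging M g W \<zeta>"
  shows "isometric_flow L D"
proof -
  have "flow_leaf L D p = orbit L \<xi> p" for p
    unfolding null_foliation_def[abs_def]
    by (rule flow_leaf_eq_orbit[OF L xi_field linear_omega xi_null(1) smooth_pullback_coords(2)])
  then have "flow_leaves L D = orbits L \<xi>" by (simp add: flow_leaves_def orbits_def)
  \<comment> \<open>The witnesses are the rigged metric itself and \<open>\<xi>\<close>.\<close>
  then show ?thesis
    unfolding isometric_flow_def
    using riemannian_flow_D riemannian_rigged_metric killing_xi[OF assms] xi_nonzero by blast
qed

end

theorem lemma2p1:
  fixes M :: "('a, 'e::euclidean_space) manifold"
    and g :: "('a, 'e) tensor2"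
    and L :: "('a, 'f::euclidean_space) manifold"
    and W :: "'a set"
    and \<zeta> :: "'a \<Rightarrow> 'e"
    and \<xi> :: "'a \<Rightarrow> 'f"
  assumes "lorentzian_manifold M g"
    and "null_hypersurface M g L"
    and "rigging M L W \<zeta>"
    and "rigged_vector_field M g L \<zeta> \<xi>"
    and "totally_geodesic M g L \<xi>"
  shows "riemannian_flow L (null_foliation \<xi>) \<and>
    bundle_like L (null_foliation \<xi>) (rigged_metric M g L \<zeta>) \<and>
    (closed_rigging M g W \<zeta> \<longrightarrow> isometric_flow L (null_foliation \<xi>))"
proof -
  interpret totally_geodesic_rigged M g L W \<zeta> \<xi>
    using assms by unfold_locales
  show ?thesis using riemannian_flow_D bundle_like_rigged_metric isometric_flow_D by blast
qed

end
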